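(* Let $g,h\in\mathbb{Z}^+$, let $\Omega\subseteq M(\mathbb{C})^g$ be a free domain and let $f:\Omega\to M(\mathbb{C})^h$ be an analytic free map. Define $F:\Omega\times M(\mathbb{C})^g\to M(\mathbb{C})^h$ by $F(X,H)=Df(X)[H]$. Then $F$ is an analytic free vector field and it is free-curl free; moreover $$DF(X,H)[K,L]=DF(X,K)[H,L]$$ for all $n\in\mathbb{Z}^+$, all $X\in\Omega[n]$ and all $H,K,L\in M_n(\mathbb{C})^g$.
   Context: Notation: $M(\mathbb{C})^g=(M_n(\mathbb{C})^g)_{n\ge 1}$ is the sequence of spaces of $g$-tuples of $n\times n$ complex matrices. A subset $\Omega\subseteq M(\mathbb{C})^g$ is a sequence $(\Omega[n])_{n\ge1}$ with $\Omega[n]\subseteq M_n(\mathbb{C})^g$. It is a free set if for all $m,n$, $X\in\Omega[n]$, $Y\in\Omega[m]$, $S\in \mathrm{GL}_n(\mathbb{C})$: $X\oplus Y=(X_1\oplus Y_1,\dots,X_g\oplus Y_g)\in\Omega[n+m]$ (block diagonal direct sums) and $S^{-1}XS=(S^{-1}X_1S,\dots,S^{-1}X_gS)\in\Omega[n]$. A free domain is a free set with every $\Omega[n]$ open in $M_n(\mathbb{C})^g$. $\Omega\times M(\mathbb{C})^g$ denotes the free set $(\Omega[n]\times M_n(\mathbb{C})^g)_{n\ge1}$. A map $f:\Omega\to M(\mathbb{C})^h$ is a sequence $f[n]:\Omega[n]\to M_n(\mathbb{C})^h$. It is a free map if $f(X\oplus Y)=f(X)\oplus f(Y)$ and $f(S^{-1}XS)=S^{-1}f(X)S$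 for all $X\in\Omega[n]$, $Y\in\Omega[m]$, $S\in\mathrm{GL}_n(\mathbb{C})$; it is analytic if each $f[n]$ is analytic. The derivative is $Df(X)[H]=\lim_{z\to0}\frac{f(X+zH)-f(X)}{z}$ for $X\in\Omega[n]$, $H\in M_n(\mathbb{C})^g$. A free vector field is a free map $T:\Omega\times M(\mathbb{C})^g\to M(\mathbb{C})^h$ that is linear in its second argument: $T(X,cH+K)=cT(X,H)+T(X,K)$ for $X\in\Omega[n]$, $H,K\in M_n(\mathbb{C})^g$, $c\in\mathbb{C}$. If $T$ is analytic, $DT(X,H)[K,L]$ denotes its derivative at the point $(X,H)$ in the direction $(K,L)$. An analytic free vector field $T$ is free-curl free if $DT(X,H)[K,0]=DT(X,K)[H,0]$ for all $n$, $X\in\Omega[n]$ and $H,K\in M_n(\mathbb{C})^g$. *)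

theory Defs
  imports "HOL-Analysis.Analysis" "Jordan_Normal_Form.Matrix"
begin

section \<open>Tuples of matrices\<close>

text \<open>
  A \<open>g\<close>-tuple of \<open>n \<times> n\<close> matrices is a list of length \<open>g\<close>. A pair \<open>(X, H)\<close> of \<open>g\<close>-tuples is
  identified with the \<open>2g\<close>-tuple \<open>X @ H\<close>, so that subsets of \<open>M(C)\<^sup>g \<times> M(C)\<^sup>g\<close> and maps on them
  are covered by the same notions as subsets of \<open>M(C)\<^sup>g\<close> and maps on them.
\<close>

type_synonym tuple = "complex mat list"

definition mat_tuples :: "nat \<Rightarrow> nat \<Rightarrow> tuple set" where
  "mat_tuples g n = {X. length X = g \<and> set X \<subseteq> carrier_mat n n}"

definition tuple_zero :: "nat \<Rightarrow> nat \<Rightarrow> tuple" where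
  "tuple_zero g n = replicate g (0\<^sub>m n n)"

definition tuple_add :: "tuple \<Rightarrow> tuple \<Rightarrow> tuple" where
  "tuple_add X Y = map2 (+) X Y"

definition tuple_diff :: "tuple \<Rightarrow> tuple \<Rightarrow> tuple" where
  "tuple_diff X Y = map2 (-) X Y"

definition tuple_smult :: "complex \<Rightarrow> tuple \<Rightarrow> tuple" where
  "tuple_smult c X = map (\<lambda>A. c \<cdot>\<^sub>m A) X"

definition mat_dsum :: "complex mat \<Rightarrow> complex mat \<Rightarrow> complex mat" where
  "mat_dsum A B = four_block_mat A (0\<^sub>m (dim_row A) (dim_col B)) (0\<^sub>m (dim_row B) (dim_col A)) B"

definition tuple_dsum :: "tuple \<Rightarrow> tuple \<Rightarrow> tuple" where
  "tuple_dsum X Y = map2 mat_dsum X Y"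

text \<open>The pairs \<open>(S, S\<^sup>-\<^sup>1)\<close> with \<open>S\<close> in \<open>GL\<^sub>n(C)\<close>; the second component is determined by the first.\<close>

definition GL_pairs :: "nat \<Rightarrow> (complex mat \<times> complex mat) set" where
  "GL_pairs n = {(S, S'). S \<in> carrier_mat n n \<and> S' \<in> carrier_mat n n
                          \<and> inverts_mat S S' \<and> inverts_mat S' S}"

definition tuple_conj :: "complex mat \<times> complex mat \<Rightarrow> tuple \<Rightarrow> tuple" where
  "tuple_conj P X = map (\<lambda>A. snd P * A * fst P) X"

section \<open>Entries, openness, analyticity, derivatives\<close>

definition tuple_index :: "nat \<Rightarrow> nat \<Rightarrow> (nat \<times> nat \<times> nat) set" where
  "tuple_index g n = {..<g} \<times> {..<n} \<times> {..<n}"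

definition entry :: "tuple \<Rightarrow> nat \<times> nat \<times> nat \<Rightarrow> complex" where
  "entry X = (\<lambda>(k, i, j). (X ! k) $$ (i, j))"

definition polydisc :: "nat \<Rightarrow> nat \<Rightarrow> tuple \<Rightarrow> real \<Rightarrow> tuple set" where
  "polydisc g n W r =
     {X \<in> mat_tuples g n. \<forall>p \<in> tuple_index g n. cmod (entry X p - entry W p) < r}"

definition open_tuples :: "nat \<Rightarrow> nat \<Rightarrow> tuple set \<Rightarrow> bool" where
  "open_tuples g n U \<longleftrightarrow>
     U \<subseteq> mat_tuples g n \<and> (\<forall>W \<in> U. \<exists>r > 0. polydisc g n W r \<subseteq> U)"

text \<open>
  Analyticity in the \<open>g n\<^sup>2\<close> complex matrix entries: near every point of the (open) set \<open>U\<close>, each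
  entry of \<open>\<phi>\<close> is the sum of an (absolutely) convergent power series in these entries. The
  functions \<open>\<alpha>\<close> are the multi-indices.
\<close>

definition analytic_tuple_map ::
    "nat \<Rightarrow> nat \<Rightarrow> nat \<Rightarrow> tuple set \<Rightarrow> (tuple \<Rightarrow> tuple) \<Rightarrow> bool" where
  "analytic_tuple_map g h n U \<phi> \<longleftrightarrow>
     (\<forall>W \<in> U. \<forall>q \<in> tuple_index h n. \<exists>r > 0. \<exists>c :: (nat \<times> nat \<times> nat \<Rightarrow> nat) \<Rightarrow> complex.
        \<forall>X \<in> U \<inter> polydisc g n W r.
          ((\<lambda>\<alpha>. c \<alpha> * (\<Prod>p \<in> tuple_index g n. (entry X p - entry W p) ^ \<alpha> p))
             has_sum entry (\<phi> X) q) (tuple_index g n \<rightarrow>\<^sub>E (UNIV :: nat set)))"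

definition tuple_Lim :: "nat \<Rightarrow> nat \<Rightarrow> 'a filter \<Rightarrow> ('a \<Rightarrow> tuple) \<Rightarrow> tuple" where
  "tuple_Lim h n F Q = map (\<lambda>k. mat n n (\<lambda>(i, j). Lim F (\<lambda>z. entry (Q z) (k, i, j)))) [0..<h]"

text \<open>
  \<open>D\<phi>(X)[H]\<close> for \<open>\<phi>\<close> with values in the \<open>h\<close>-tuples of \<open>n \<times> n\<close> matrices. If \<open>\<phi>\<close> is analytic on an
  open set containing \<open>X\<close>, then \<open>X + zH\<close> lies in that set for all small \<open>z\<close> and the limit exists.
\<close>

definition tuple_deriv ::
    "nat \<Rightarrow> nat \<Rightarrow> (tuple \<Rightarrow> tuple) \<Rightarrow> tuple \<Rightarrow> tuple \<Rightarrow> tuple" where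
  "tuple_deriv h n \<phi> X H =
     tuple_Lim h n (at (0 :: complex))
       (\<lambda>z. tuple_smult (1 / z) (tuple_diff (\<phi> (tuple_add X (tuple_smult z H))) (\<phi> X)))"

section \<open>Free sets, free maps, free vector fields\<close>

text \<open>Sequences indexed by \<open>n \<ge> 1\<close> are functions on \<open>nat\<close> whose value at \<open>0\<close> is ignored.\<close>

definition free_set :: "nat \<Rightarrow> (nat \<Rightarrow> tuple set) \<Rightarrow> bool" where
  "free_set g \<Omega> \<longleftrightarrow>
     (\<forall>n \<ge> 1. \<Omega> n \<subseteq> mat_tuples g n) \<and>
     (\<forall>n \<ge> 1. \<forall>m \<ge> 1. \<forall>X \<in> \<Omega> n. \<forall>Y \<in> \<Omega> m. tuple_dsum X Y \<in> \<Omega> (n + m)) \<and>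
     (\<forall>n \<ge> 1. \<forall>X \<in> \<Omega> n. \<forall>P \<in> GL_pairs n. tuple_conj P X \<in> \<Omega> n)"

definition free_domain :: "nat \<Rightarrow> (nat \<Rightarrow> tuple set) \<Rightarrow> bool" where
  "free_domain g \<Omega> \<longleftrightarrow> free_set g \<Omega> \<and> (\<forall>n \<ge> 1. open_tuples g n (\<Omega> n))"

definition times_all :: "nat \<Rightarrow> (nat \<Rightarrow> tuple set) \<Rightarrow> nat \<Rightarrow> tuple set" where
  "times_all g \<Omega> n = {X @ H | X H. X \<in> \<Omega> n \<and> H \<in> mat_tuples g n}"

definition free_map ::
    "nat \<Rightarrow> (nat \<Rightarrow> tuple set) \<Rightarrow> (nat \<Rightarrow> tuple \<Rightarrow> tuple) \<Rightarrow> bool" where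
  "free_map h \<Omega> f \<longleftrightarrow>
     (\<forall>n \<ge> 1. \<forall>X \<in> \<Omega> n. f n X \<in> mat_tuples h n) \<and>
     (\<forall>n \<ge> 1. \<forall>m \<ge> 1. \<forall>X \<in> \<Omega> n. \<forall>Y \<in> \<Omega> m.
        f (n + m) (tuple_dsum X Y) = tuple_dsum (f n X) (f m Y)) \<and>
     (\<forall>n \<ge> 1. \<forall>X \<in> \<Omega> n. \<forall>P \<in> GL_pairs n. f n (tuple_conj P X) = tuple_conj P (f n X))"

definition analytic_map ::
    "nat \<Rightarrow> nat \<Rightarrow> (nat \<Rightarrow> tuple set) \<Rightarrow> (nat \<Rightarrow> tuple \<Rightarrow> tuple) \<Rightarrow> bool" where
  "analytic_map g h \<Omega> f \<longleftrightarrow> (\<forall>n \<ge> 1. analytic_tuple_map g h n (\<Omega> n) (f n))"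

definition free_vector_field ::
    "nat \<Rightarrow> nat \<Rightarrow> (nat \<Rightarrow> tuple set) \<Rightarrow> (nat \<Rightarrow> tuple \<Rightarrow> tuple) \<Rightarrow> bool" where
  "free_vector_field g h \<Omega> T \<longleftrightarrow>
     free_map h (times_all g \<Omega>) T \<and>
     (\<forall>n \<ge> 1. \<forall>X \<in> \<Omega> n. \<forall>H \<in> mat_tuples g n. \<forall>K \<in> mat_tuples g n. \<forall>c.
        T n (X @ tuple_add (tuple_smult c H) K)
          = tuple_add (tuple_smult c (T n (X @ H))) (T n (X @ K)))"

definition analytic_free_vector_field ::
    "nat \<Rightarrow> nat \<Rightarrow> (nat \<Rightarrow> tuple set) \<Rightarrow> (nat \<Rightarrow> tuple \<Rightarrow> tuple) \<Rightarrow> bool" where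
  "analytic_free_vector_field g h \<Omega> T \<longleftrightarrow>
     free_vector_field g h \<Omega> T \<and> analytic_map (2 * g) h (times_all g \<Omega>) T"

definition free_curl_free ::
    "nat \<Rightarrow> nat \<Rightarrow> (nat \<Rightarrow> tuple set) \<Rightarrow> (nat \<Rightarrow> tuple \<Rightarrow> tuple) \<Rightarrow> bool" where
  "free_curl_free g h \<Omega> T \<longleftrightarrow>
     (\<forall>n \<ge> 1. \<forall>X \<in> \<Omega> n. \<forall>H \<in> mat_tuples g n. \<forall>K \<in> mat_tuples g n.
        tuple_deriv h n (T n) (X @ H) (K @ tuple_zero g n)
          = tuple_deriv h n (T n) (X @ K) (H @ tuple_zero g n))"

end

theory Submission
  imports Defs "HOL-Complex_Analysis.Cauchy_Integral_Formula"
begin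

text \<open>
  Near a point \<open>W\<close> every entry of \<open>f\<close> is a power series \<open>G\<close> in the entries of \<open>X - W\<close>. Such a
  series converges uniformly on slightly smaller polydiscs, so it may be differentiated termwise
  along complex lines; hence the corresponding entry of \<open>Df(X)[H]\<close> is \<open>\<Sum>\<^sub>p H\<^sub>p G\<^sub>p(X - W)\<close>, where \<open>G\<^sub>p\<close>
  is the formal partial derivative of \<open>G\<close>. This is linear in \<open>H\<close> and analytic in \<open>(X, H)\<close>, and
  differentiating once more gives \<open>DF(X,H)[K,L] = \<Sum>\<^sub>p L\<^sub>p G\<^sub>p + \<Sum>\<^sub>p\<^sub>,\<^sub>q H\<^sub>p K\<^sub>q G\<^sub>p\<^sub>q\<close>, which is symmetric in
  \<open>H\<close> and \<open>K\<close> because formal partial derivatives commute. Freeness passes from \<open>f\<close> to its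
  difference quotients, and so to the limit.
\<close>

section \<open>Power series in finitely many complex variables\<close>

definition monom_at :: "'i set \<Rightarrow> ('i \<Rightarrow> nat) \<Rightarrow> ('i \<Rightarrow> complex) \<Rightarrow> complex" where
  "monom_at I \<alpha> x = (\<Prod>p\<in>I. x p ^ \<alpha> p)"

text \<open>Multi-indices are extensional functions, so each is determined by its values on
  \<open>I\<close> and no monomial is counted twice. This is also the index set used in
  \<open>analytic_tuple_map\<close>.\<close>

definition multi_indices :: "'i set \<Rightarrow> ('i \<Rightarrow> nat) set" where
  "multi_indices I = (I \<rightarrow>\<^sub>E UNIV)"

text \<open>Points are total functions, but only their values on \<open>I\<close> enter, and
  \<open>G\<close> is unconstrained off the polydisc of radius \<open>r\<close> about 0. The same
  \<open>G\<close> can therefore be kept when \<open>I\<close> is enlarged.\<close>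

definition has_power_series ::
    "'i set \<Rightarrow> real \<Rightarrow> (('i \<Rightarrow> nat) \<Rightarrow> complex) \<Rightarrow> (('i \<Rightarrow> complex) \<Rightarrow> complex) \<Rightarrow> bool" where
  "has_power_series I r c G \<longleftrightarrow>
     (\<forall>x. (\<forall>p\<in>I. cmod (x p) < r) \<longrightarrow>
          ((\<lambda>\<alpha>. c \<alpha> * monom_at I \<alpha> x) has_sum G x) (multi_indices I))"

lemma has_power_seriesD:
  assumes "has_power_series I r c G" and "\<And>p. p \<in> I \<Longrightarrow> cmod (x p) < r"
  shows "((\<lambda>\<alpha>. c \<alpha> * monom_at I \<alpha> x) has_sum G x) (multi_indices I)"
  using assms by (auto simp: has_power_series_def)

lemma monom_at_cong: "(\<And>p. p \<in> I \<Longrightarrow> x p = y p) \<Longrightarrow> monom_at I \<alpha> x = monom_at I \<alpha> y"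
  unfolding monom_at_def by (intro prod.cong) auto

text \<open>Monomials see only coordinates in \<open>I\<close>, so both points give the same series
  and sums are unique. This is needed because the formulas for \<open>entry\<close> hold only at
  valid indices.\<close>

lemma has_power_series_local:
  assumes "has_power_series I r c G" and "\<And>p. p \<in> I \<Longrightarrow> cmod (x p) < r"
    and "\<And>p. p \<in> I \<Longrightarrow> x p = y p"
  shows "G x = G y"
proof -
  have "((\<lambda>\<alpha>. c \<alpha> * monom_at I \<alpha> x) has_sum G x) (multi_indices I)"
    using assms by (intro has_power_seriesD)
  moreover have "((\<lambda>\<alpha>. c \<alpha> * monom_at I \<alpha> y) has_sum G y) (multi_indices I)"
    using assms by (intro has_power_seriesD[OF assms(1)]) auto
  moreover have "monom_at I \<alpha> x = monom_at I \<alpha> y" for \<alpha>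
    using assms(3) by (rule monom_at_cong)
  ultimately show ?thesis
    by (simp add: has_sum_unique)
qed

lemma has_power_series_unique:
  assumes "has_power_series I r c G" "has_power_series I r c G'" "\<And>p. p \<in> I \<Longrightarrow> cmod (x p) < r"
  shows "G x = G' x"
  using has_power_seriesD[OF assms(1,3)] has_power_seriesD[OF assms(2,3)] by (rule has_sum_unique)

lemma has_power_series_add:
  assumes "has_power_series I r c G" "has_power_series I r d K"
  shows "has_power_series I r (\<lambda>\<alpha>. c \<alpha> + d \<alpha>) (\<lambda>x. G x + K x)"
  using assms unfolding has_power_series_def
  by (auto simp: distrib_right intro!: has_sum_add)

lemma has_power_series_cmult:
  assumes "has_power_series I r c G"
  shows "has_power_series I r (\<lambda>\<alpha>. a * c \<alpha>) (\<lambda>x. a * G x)"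
  using assms unfolding has_power_series_def
  by (auto simp: mult.assoc intro!: has_sum_cmult_right)

lemma has_sum_finite_sum:
  fixes f :: "'b \<Rightarrow> 'a \<Rightarrow> 'c::topological_comm_monoid_add"
  assumes "finite B" "\<And>b. b \<in> B \<Longrightarrow> (f b has_sum s b) A"
  shows "((\<lambda>a. \<Sum>b\<in>B. f b a) has_sum (\<Sum>b\<in>B. s b)) A"
  using assms by (induction rule: finite_induct) (auto intro!: has_sum_add)

lemma has_power_series_sum:
  assumes "finite A" "\<And>a. a \<in> A \<Longrightarrow> has_power_series I r (c a) (G a)"
  shows "has_power_series I r (\<lambda>\<alpha>. \<Sum>a\<in>A. c a \<alpha>) (\<lambda>x. \<Sum>a\<in>A. G a x)"
  using assms unfolding has_power_series_def
  by (auto simp: sum_distrib_right intro!: has_sum_finite_sum)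

lemma monom_at_split:
  assumes "finite I" "p \<in> I"
  shows "monom_at I \<alpha> x = x p ^ \<alpha> p * (\<Prod>q\<in>I - {p}. x q ^ \<alpha> q)"
  using assms unfolding monom_at_def by (simp add: prod.remove)

lemma monom_at_upd:
  assumes "finite I" "p \<in> I"
  shows "monom_at I (\<alpha>(p := k)) x = x p ^ k * (\<Prod>q\<in>I - {p}. x q ^ \<alpha> q)"
  using assms by (simp add: monom_at_split)

text \<open>Raising the exponent of \<open>p\<close> is the reindexing behind both multiplication by
  \<open>x p\<close> and differentiation in \<open>x p\<close>.\<close>

lemma multi_indices_Suc:
  assumes "p \<in> I"
  shows "(\<lambda>\<alpha>. \<alpha>(p := Suc (\<alpha> p))) ` multi_indices I = {\<beta> \<in> multi_indices I. \<beta> p \<noteq> 0}" (is "?s ` _ = ?R")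
    and "inj_on (\<lambda>\<alpha>. \<alpha>(p := Suc (\<alpha> p))) (multi_indices I)"
proof -
  show "?s ` multi_indices I = ?R"
  proof (intro equalityI subsetI)
    fix \<beta> assume "\<beta> \<in> ?R"
    then have "?s (\<beta>(p := \<beta> p - 1)) = \<beta>" "\<beta>(p := \<beta> p - 1) \<in> multi_indices I"
      using assms by (auto simp: multi_indices_def PiE_iff extensional_def)
    then show "\<beta> \<in> ?s ` multi_indices I"
      by (intro image_eqI[of _ _ "\<beta>(p := \<beta> p - 1)"]) auto
  qed (use assms in \<open>auto simp: multi_indices_def PiE_iff extensional_def\<close>)
  show "inj_on ?s (multi_indices I)"
  proof (rule inj_onI, rule ext)
    fix \<alpha> \<beta> q assume "?s \<alpha> = ?s \<beta>"
    then have "?s \<alpha> q = ?s \<beta> q" "?s \<alpha> p = ?s \<beta> p" by simp_all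
    then show "\<alpha> q = \<beta> q" by (auto split: if_splits)
  qed
qed

text \<open>Multiplication by \<open>x p\<close> shifts every exponent of \<open>p\<close> up by
  one. Multi-indices with exponent 0 at \<open>p\<close> are not reached, so they receive
  coefficient 0 and can be added back to the sum.\<close>

lemma has_power_series_times_var:
  assumes "finite I" "p \<in> I" "has_power_series I r c G"
  shows "has_power_series I r (\<lambda>\<beta>. if \<beta> p = 0 then 0 else c (\<beta>(p := \<beta> p - 1))) (\<lambda>x. x p * G x)"
  unfolding has_power_series_def
proof (intro allI impI)
  fix x assume x: "\<forall>p\<in>I. cmod (x p) < r"
  let ?d = "\<lambda>\<beta>. if \<beta> p = 0 then 0 else c (\<beta>(p := \<beta> p - 1))"
  let ?s = "\<lambda>\<alpha>. \<alpha>(p := Suc (\<alpha> p))"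
  have "((\<lambda>\<alpha>. x p * (c \<alpha> * monom_at I \<alpha> x)) has_sum x p * G x) (multi_indices I)"
    using x by (intro has_sum_cmult_right has_power_seriesD[OF assms(3)]) auto
  also have "(\<lambda>\<alpha>. x p * (c \<alpha> * monom_at I \<alpha> x)) = (\<lambda>\<beta>. ?d \<beta> * monom_at I \<beta> x) \<circ> ?s"
    using assms(1,2) by (auto simp: fun_eq_iff monom_at_upd monom_at_split)
  finally have "((\<lambda>\<beta>. ?d \<beta> * monom_at I \<beta> x) has_sum x p * G x) {\<beta> \<in> multi_indices I. \<beta> p \<noteq> 0}"
    unfolding multi_indices_Suc(1)[OF assms(2), symmetric]
    by (subst has_sum_reindex[OF multi_indices_Suc(2)[OF assms(2)]])
  then show "((\<lambda>\<beta>. ?d \<beta> * monom_at I \<beta> x) has_sum x p * G x) (multi_indices I)"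
    by (rule has_sum_cong_neutral[THEN iffD1, rotated -1]) auto
qed

text \<open>Multi-indices on \<open>I\<close> are padded by zeros, and those that involve a new
  variable get coefficient 0. Thus a series in the entries of \<open>X\<close> also counts as one in
  the entries of the pair \<open>X @ H\<close>.\<close>

lemma has_power_series_extend:
  assumes "finite J" "I \<subseteq> J" "has_power_series I r c G"
  shows "has_power_series J r (\<lambda>\<beta>. if \<forall>p\<in>J - I. \<beta> p = 0 then c (restrict \<beta> I) else 0) G"
  unfolding has_power_series_def
proof (intro allI impI)
  fix x assume x: "\<forall>p\<in>J. cmod (x p) < r"
  let ?d = "\<lambda>\<beta>. if \<forall>p\<in>J - I. \<beta> p = 0 then c (restrict \<beta> I) else 0"
  \<comment> \<open>Only \<open>J - I\<close> is overwritten: outside \<open>J\<close> the value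
    must remain \<open>undefined\<close> for the result to be extensional on
    \<open>J\<close>.\<close>
  let ?e = "\<lambda>\<alpha> p. if p \<in> J - I then 0 else \<alpha> p"
  let ?R = "{\<beta> \<in> multi_indices J. \<forall>p\<in>J - I. \<beta> p = 0}"
  have inj: "inj_on ?e (multi_indices I)"
  proof (rule inj_onI, rule ext)
    fix \<alpha> \<beta> q assume "\<alpha> \<in> multi_indices I" "\<beta> \<in> multi_indices I" "?e \<alpha> = ?e \<beta>"
    moreover from this have "?e \<alpha> q = ?e \<beta> q" by metis
    ultimately show "\<alpha> q = \<beta> q"
      by (auto simp: multi_indices_def PiE_iff extensional_def split: if_splits)
  qed
  have img: "?e ` multi_indices I = ?R"
  proof (intro equalityI subsetI)
    fix \<beta> assume "\<beta> \<in> ?R"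
    then have "?e (restrict \<beta> I) = \<beta>" "restrict \<beta> I \<in> multi_indices I"
      using assms(2) by (auto simp: multi_indices_def PiE_iff extensional_def fun_eq_iff)
    then show "\<beta> \<in> ?e ` multi_indices I"
      by (intro image_eqI[of _ _ "restrict \<beta> I"]) auto
  qed (use assms(2) in \<open>auto simp: multi_indices_def PiE_iff extensional_def\<close>)
  have "((\<lambda>\<alpha>. c \<alpha> * monom_at I \<alpha> x) has_sum G x) (multi_indices I)"
    using x assms(2) by (intro has_power_seriesD[OF assms(3)]) auto
  also have "?this \<longleftrightarrow> (((\<lambda>\<beta>. ?d \<beta> * monom_at J \<beta> x) \<circ> ?e) has_sum G x) (multi_indices I)"
  proof (rule has_sum_cong)
    fix \<alpha> assume \<alpha>: "\<alpha> \<in> multi_indices I"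
    have "restrict (?e \<alpha>) I = \<alpha>"
      using \<alpha> assms(2) by (auto simp: multi_indices_def PiE_iff extensional_def fun_eq_iff)
    moreover have "monom_at J (?e \<alpha>) x = monom_at I \<alpha> x"
      unfolding monom_at_def using assms(1,2) by (intro prod.mono_neutral_cong_right) auto
    ultimately show "c \<alpha> * monom_at I \<alpha> x = ((\<lambda>\<beta>. ?d \<beta> * monom_at J \<beta> x) \<circ> ?e) \<alpha>"
      by simp
  qed
  finally have "((\<lambda>\<beta>. ?d \<beta> * monom_at J \<beta> x) has_sum G x) ?R"
    unfolding img[symmetric] by (subst has_sum_reindex[OF inj])
  then show "((\<lambda>\<beta>. ?d \<beta> * monom_at J \<beta> x) has_sum G x) (multi_indices J)"
    by (rule has_sum_cong_neutral[THEN iffD1, rotated -1]) auto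
qed

section \<open>Formal partial derivatives and termwise differentiation along complex lines\<close>

text \<open>Coefficients of the formal partial derivative in the variable \<open>p\<close>, already
  reindexed: the one at \<open>\<beta>\<close> stems from the monomial whose exponent at
  \<open>p\<close> is one higher.\<close>

definition pderiv_coeff :: "'i \<Rightarrow> (('i \<Rightarrow> nat) \<Rightarrow> complex) \<Rightarrow> ('i \<Rightarrow> nat) \<Rightarrow> complex" where
  "pderiv_coeff p c \<beta> = of_nat (Suc (\<beta> p)) * c (\<beta>(p := Suc (\<beta> p)))"

text \<open>For distinct variables the two shifts change different exponents and the integer factors
  commute. The symmetry of second derivatives rests on this identity.\<close>

lemma pderiv_coeff_commute: "pderiv_coeff p (pderiv_coeff q c) = pderiv_coeff q (pderiv_coeff p c)"
  by (cases "p = q") (auto simp: pderiv_coeff_def fun_eq_iff fun_upd_twist)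

text \<open>The exponent below truncates to \<open>0\<close> for \<open>\<alpha> p = 0\<close>, where the factor \<open>\<alpha> p\<close> vanishes.\<close>

definition monom_pderiv :: "'i set \<Rightarrow> 'i \<Rightarrow> ('i \<Rightarrow> nat) \<Rightarrow> ('i \<Rightarrow> complex) \<Rightarrow> complex" where
  "monom_pderiv I p \<alpha> x = of_nat (\<alpha> p) * x p ^ (\<alpha> p - 1) * (\<Prod>q\<in>I - {p}. x q ^ \<alpha> q)"

lemma monom_line_deriv:
  assumes "finite I"
  shows "((\<lambda>z. monom_at I \<alpha> (\<lambda>p. x p + z * y p)) has_field_derivative
            (\<Sum>p\<in>I. y p * monom_pderiv I p \<alpha> (\<lambda>p. x p + z * y p))) (at z)"
proof -
  have "((\<lambda>z. \<Prod>p\<in>I. (x p + z * y p) ^ \<alpha> p) has_field_derivative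
          (\<Sum>p\<in>I. (of_nat (\<alpha> p) * (y p * (x p + z * y p) ^ (\<alpha> p - 1))) * 
               (\<Prod>q\<in>I - {p}. (x q + z * y q) ^ \<alpha> q))) (at z)"
    by (rule has_field_derivative_prod) (auto intro!: derivative_eq_intros)
  then show ?thesis
    unfolding monom_at_def monom_pderiv_def by (simp add: mult_ac)
qed

text \<open>Restricted to a line, the partial sums are polynomials in one complex variable
  \<open>z\<close>. They converge uniformly on a small disc, so Weierstrass' theorem on limits of
  holomorphic functions yields the derivative of the limit and the convergence of the differentiated
  sums together.\<close>

lemma has_power_series_line_deriv_aux:
  assumes I: "finite I" and G: "has_power_series I r c G"
    and x: "\<And>p. p \<in> I \<Longrightarrow> cmod (x p) < r"
  obtains D where "((\<lambda>z. G (\<lambda>p. x p + z * y p)) has_field_derivative D) (at 0)"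
    and "((\<lambda>\<alpha>. c \<alpha> * (\<Sum>p\<in>I. y p * monom_pderiv I p \<alpha> x)) has_sum D) (multi_indices I)"
proof -
  obtain \<rho> where \<rho>: "\<rho> < r" "\<And>p. p \<in> I \<Longrightarrow> cmod (x p) < \<rho>"
  proof -
    \<comment> \<open>The element \<open>r - 1\<close> lies below \<open>r\<close> and keeps
      \<open>S\<close> nonempty when \<open>I\<close> is empty, so that \<open>Max S\<close> makes
      sense.\<close>
    define S where "S = insert (r - 1) ((\<lambda>p. cmod (x p)) ` I)"
    have "finite S" "S \<noteq> {}" using I by (auto simp: S_def)
    then have "Max S < r" using x by (auto simp: S_def)
    then obtain \<rho> where "Max S < \<rho>" "\<rho> < r" using dense by blast
    moreover have "s \<le> Max S" if "s \<in> S" for s using that \<open>finite S\<close> by simp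
    ultimately have "cmod (x p) < \<rho>" if "p \<in> I" for p
      using that by (intro le_less_trans[OF _ \<open>Max S < \<rho>\<close>]) (auto simp: S_def)
    with \<open>\<rho> < r\<close> show ?thesis using that by blast
  qed
  \<comment> \<open>The parameters for which the line stays in the smaller polydisc of radius
    \<rho>. As a finite intersection of open sets it contains a closed disc about 0.\<close>
  define U where "U = {z. \<forall>p\<in>I. cmod (x p + z * y p) < \<rho>}"
  have "open U"
  proof -
    have "U = (\<Inter>p\<in>I. {z. cmod (x p + z * y p) < \<rho>})" by (auto simp: U_def)
    then show ?thesis
      using I by (auto intro!: open_INT open_Collect_less continuous_intros)
  qed
  moreover have "0 \<in> U" using \<rho> by (auto simp: U_def)
  ultimately obtain \<delta> where \<delta>: "\<delta> > 0" "cball 0 \<delta> \<subseteq> U"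
    by (meson open_contains_cball)
  let ?s = "\<lambda>z p. x p + z * y p"
  let ?f = "\<lambda>\<alpha> z. c \<alpha> * monom_at I \<alpha> (?s z)"
  let ?f' = "\<lambda>\<alpha> z. c \<alpha> * (\<Sum>p\<in>I. y p * monom_pderiv I p \<alpha> (?s z))"
  \<comment> \<open>The majorant is the series at the point with all coordinates \<rho>. That point
    lies in the polydisc of radius \<open>r\<close>, where summability over the multi-indices is
    automatically absolute.\<close>
  let ?M = "\<lambda>\<alpha>. norm (c \<alpha> * monom_at I \<alpha> (\<lambda>_. of_real \<rho>))"
  have U: "cmod (?s z p) < \<rho>" if "z \<in> cball 0 \<delta>" "p \<in> I" for z :: complex and p
    using \<delta> that by (auto simp: U_def)
  have \<rho>0: "cmod (of_real \<rho>) < r" if "p \<in> I" for p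
    using \<rho> that norm_ge_zero[of "x p"] by (smt (verit, best) norm_of_real)
  have ul: "uniform_limit (cball 0 \<delta>) (\<lambda>A z. \<Sum>\<alpha>\<in>A. ?f \<alpha> z) (\<lambda>z. G (?s z))
          (finite_subsets_at_top (multi_indices I))"
  proof (rule Weierstrass_m_test_general')
    fix \<alpha> and z :: complex assume z: "z \<in> cball 0 \<delta>"
    have "cmod (monom_at I \<alpha> (?s z)) \<le> cmod (monom_at I \<alpha> (\<lambda>_. of_real \<rho>))"
      unfolding monom_at_def prod_norm[symmetric] norm_power
      using U[OF z] by (intro prod_mono conjI power_mono)
        (auto intro: less_imp_le order.trans[OF _ abs_ge_self])
    then show "norm (?f \<alpha> z) \<le> ?M \<alpha>"
      by (simp add: norm_mult mult_left_mono)
  next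
    fix z :: complex assume "z \<in> cball 0 \<delta>"
    then show "((\<lambda>\<alpha>. ?f \<alpha> z) has_sum G (?s z)) (multi_indices I)"
      using U \<rho>(1) by (intro has_power_seriesD[OF G]) (meson less_trans)
  next
    have "(\<lambda>\<alpha>. c \<alpha> * monom_at I \<alpha> (\<lambda>_. of_real \<rho>)) summable_on multi_indices I"
      using \<rho>0 by (intro has_sum_imp_summable[OF has_power_seriesD[OF G]])
    then show "?M summable_on multi_indices I"
      by (simp only: summable_on_iff_abs_summable_on_complex)
  qed
  have d: "((\<lambda>z. \<Sum>\<alpha>\<in>A. ?f \<alpha> z) has_field_derivative (\<Sum>\<alpha>\<in>A. ?f' \<alpha> z)) (at z)" for A and z :: complex
    by (intro DERIV_sum DERIV_cmult monom_line_deriv[OF I])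
  moreover have "continuous_on (cball 0 \<delta>) (\<lambda>z. \<Sum>\<alpha>\<in>A. ?f \<alpha> z)" for A
    by (intro DERIV_continuous_on) (rule has_field_derivative_at_within[OF d])
  ultimately have ev: "\<forall>\<^sub>F A in finite_subsets_at_top (multi_indices I).
      continuous_on (cball 0 \<delta>) (\<lambda>z. \<Sum>\<alpha>\<in>A. ?f \<alpha> z) \<and>
      (\<forall>w\<in>ball 0 \<delta>. ((\<lambda>z. \<Sum>\<alpha>\<in>A. ?f \<alpha> z) has_field_derivative (\<Sum>\<alpha>\<in>A. ?f' \<alpha> w)) (at w))"
    by (intro always_eventually) blast
  obtain g' where "\<And>w. w \<in> ball 0 \<delta> \<Longrightarrow> ((\<lambda>z. G (?s z)) has_field_derivative g' w) (at w) \<and>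
      ((\<lambda>A. \<Sum>\<alpha>\<in>A. ?f' \<alpha> w) \<longlongrightarrow> g' w) (finite_subsets_at_top (multi_indices I))"
    by (rule has_complex_derivative_uniform_limit[OF ev ul finite_subsets_at_top_neq_bot \<delta>(1)]) blast
  from this[of 0] have "((\<lambda>z. G (?s z)) has_field_derivative g' 0) (at 0)"
      "((\<lambda>A. \<Sum>\<alpha>\<in>A. ?f' \<alpha> 0) \<longlongrightarrow> g' 0) (finite_subsets_at_top (multi_indices I))"
    using \<delta>(1) by simp_all
  then show ?thesis
    using that unfolding has_sum_def by simp
qed

text \<open>Along the unit vector in direction \<open>p\<close> the line derivative reduces to the
  single partial derivative, which gives its summability. Terms with exponent 0 at \<open>p\<close>
  vanish; reindexing the others produces \<open>pderiv_coeff\<close>.\<close>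

lemma has_sum_monom_pderiv:
  assumes I: "finite I" "p \<in> I" and G: "has_power_series I r c G"
    and x: "\<And>p. p \<in> I \<Longrightarrow> cmod (x p) < r"
  obtains s where "((\<lambda>\<alpha>. c \<alpha> * monom_pderiv I p \<alpha> x) has_sum s) (multi_indices I)"
    and "((\<lambda>\<alpha>. pderiv_coeff p c \<alpha> * monom_at I \<alpha> x) has_sum s) (multi_indices I)"
proof -
  let ?s = "\<lambda>\<alpha>. \<alpha>(p := Suc (\<alpha> p))"
  obtain D where "((\<lambda>\<alpha>. c \<alpha> * (\<Sum>q\<in>I. (if q = p then 1 else 0) * monom_pderiv I q \<alpha> x)) has_sum D)
      (multi_indices I)"
    using has_power_series_line_deriv_aux[where x = x and y = "\<lambda>q. if q = p then 1 else 0", OF I(1) G x]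
    by blast
  then have D: "((\<lambda>\<alpha>. c \<alpha> * monom_pderiv I p \<alpha> x) has_sum D) (multi_indices I)"
    using I by (simp add: if_distrib[of "\<lambda>t. t * _"] cong: if_cong)
  then have "((\<lambda>\<alpha>. c \<alpha> * monom_pderiv I p \<alpha> x) has_sum D) {\<beta> \<in> multi_indices I. \<beta> p \<noteq> 0}"
    by (rule has_sum_cong_neutral[THEN iffD1, rotated -1]) (auto simp: monom_pderiv_def)
  then have "((\<lambda>\<alpha>. c \<alpha> * monom_pderiv I p \<alpha> x) \<circ> ?s has_sum D) (multi_indices I)"
    unfolding multi_indices_Suc(1)[OF I(2), symmetric]
    by (subst (asm) has_sum_reindex[OF multi_indices_Suc(2)[OF I(2)]])
  also have "(\<lambda>\<alpha>. c \<alpha> * monom_pderiv I p \<alpha> x) \<circ> ?s = (\<lambda>\<alpha>. pderiv_coeff p c \<alpha> * monom_at I \<alpha> x)"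
    using I by (auto simp: fun_eq_iff monom_pderiv_def pderiv_coeff_def monom_at_split)
  finally show ?thesis using D that by blast
qed

lemma has_power_series_pderiv:
  assumes "finite I" "p \<in> I" "has_power_series I r c G"
  obtains G' where "has_power_series I r (pderiv_coeff p c) G'"
proof -
  \<comment> \<open>The implication stands inside the existential so that a value can be chosen at
    every \<open>x\<close>, including points outside the polydisc.\<close>
  have "\<exists>s. (\<forall>p\<in>I. cmod (x p) < r) \<longrightarrow>
      ((\<lambda>\<alpha>. pderiv_coeff p c \<alpha> * monom_at I \<alpha> x) has_sum s) (multi_indices I)" for x
    using has_sum_monom_pderiv[OF assms, of x] by meson
  then show ?thesis
    using that unfolding has_power_series_def by metis
qed

text \<open>Each partial series is now summable by itself, so the finite sum over \<open>p\<close>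
  may be pulled out of the series; uniqueness of sums then identifies \<open>D\<close>.\<close>

lemma has_power_series_line_deriv:
  assumes I: "finite I" and G: "has_power_series I r c G"
    and G': "\<And>p. p \<in> I \<Longrightarrow> has_power_series I r (pderiv_coeff p c) (G' p)"
    and x: "\<And>p. p \<in> I \<Longrightarrow> cmod (x p) < r"
  shows "((\<lambda>z. G (\<lambda>p. x p + z * y p)) has_field_derivative (\<Sum>p\<in>I. y p * G' p x)) (at 0)"
proof -
  obtain D where D: "((\<lambda>z. G (\<lambda>p. x p + z * y p)) has_field_derivative D) (at 0)"
    and S: "((\<lambda>\<alpha>. c \<alpha> * (\<Sum>p\<in>I. y p * monom_pderiv I p \<alpha> x)) has_sum D) (multi_indices I)"
    using has_power_series_line_deriv_aux[where x = x and y = y, OF I G x] by blast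
  have "((\<lambda>\<alpha>. c \<alpha> * monom_pderiv I p \<alpha> x) has_sum G' p x) (multi_indices I)" if p: "p \<in> I" for p
  proof -
    obtain s where s: "((\<lambda>\<alpha>. c \<alpha> * monom_pderiv I p \<alpha> x) has_sum s) (multi_indices I)"
        "((\<lambda>\<alpha>. pderiv_coeff p c \<alpha> * monom_at I \<alpha> x) has_sum s) (multi_indices I)"
      using has_sum_monom_pderiv[where x = x, OF I p G x] by blast
    have "s = G' p x"
      using s(2) has_power_seriesD[where x = x, OF G'[OF p] x] by (rule has_sum_unique)
    with s(1) show ?thesis by simp
  qed
  then have "((\<lambda>\<alpha>. \<Sum>p\<in>I. y p * (c \<alpha> * monom_pderiv I p \<alpha> x)) has_sum (\<Sum>p\<in>I. y p * G' p x))
      (multi_indices I)"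
    using I by (intro has_sum_finite_sum has_sum_cmult_right)
  then have "((\<lambda>\<alpha>. c \<alpha> * (\<Sum>p\<in>I. y p * monom_pderiv I p \<alpha> x)) has_sum (\<Sum>p\<in>I. y p * G' p x))
      (multi_indices I)"
    by (simp add: sum_distrib_left mult_ac)
  with S have "D = (\<Sum>p\<in>I. y p * G' p x)" by (rule has_sum_unique)
  with D show ?thesis by simp
qed

section \<open>Tuples of matrices and their derivatives\<close>

lemma mat_tuples_nth: "X \<in> mat_tuples g n \<Longrightarrow> k < g \<Longrightarrow> X ! k \<in> carrier_mat n n"
  by (auto simp: mat_tuples_def dest: nth_mem)

lemma mat_tuples_length: "X \<in> mat_tuples g n \<Longrightarrow> length X = g"
  by (simp add: mat_tuples_def)

lemma mat_tuplesI:
  assumes "length X = g" "\<And>k. k < g \<Longrightarrow> X ! k \<in> carrier_mat n n"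
  shows "X \<in> mat_tuples g n"
  using assms unfolding mat_tuples_def by (auto simp: in_set_conv_nth)

lemma mat_tuples_eqI:
  assumes "X \<in> mat_tuples g n" "Y \<in> mat_tuples g n"
    and "\<And>p. p \<in> tuple_index g n \<Longrightarrow> entry X p = entry Y p"
  shows "X = Y"
proof (rule nth_equalityI)
  show "length X = length Y" using assms by (simp add: mat_tuples_length)
  fix k assume "k < length X"
  then have k: "k < g" using assms by (simp add: mat_tuples_length)
  note c = mat_tuples_nth[OF assms(1) k] mat_tuples_nth[OF assms(2) k]
  show "X ! k = Y ! k"
  proof (rule eq_matI)
    fix i j assume "i < dim_row (Y ! k)" "j < dim_col (Y ! k)"
    then show "(X ! k) $$ (i, j) = (Y ! k) $$ (i, j)"
      using c k assms(3)[of "(k, i, j)"] by (auto simp: tuple_index_def entry_def)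
  qed (use c in auto)
qed

lemma finite_tuple_index [simp]: "finite (tuple_index g n)"
  by (simp add: tuple_index_def)

lemma tuple_add_closed:
  "X \<in> mat_tuples g n \<Longrightarrow> Y \<in> mat_tuples g n \<Longrightarrow> tuple_add X Y \<in> mat_tuples g n"
  by (rule mat_tuplesI) (auto simp: tuple_add_def mat_tuples_length
      intro!: add_carrier_mat mat_tuples_nth)

lemma tuple_smult_closed: "X \<in> mat_tuples g n \<Longrightarrow> tuple_smult c X \<in> mat_tuples g n"
  by (rule mat_tuplesI) (auto simp: tuple_smult_def mat_tuples_length
      intro!: smult_carrier_mat mat_tuples_nth)

lemma tuple_diff_closed:
  "X \<in> mat_tuples g n \<Longrightarrow> Y \<in> mat_tuples g n \<Longrightarrow> tuple_diff X Y \<in> mat_tuples g n"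
  by (rule mat_tuplesI) (auto simp: tuple_diff_def mat_tuples_length
      intro!: mat_tuples_nth minus_carrier_mat)

lemma tuple_zero_closed: "tuple_zero g n \<in> mat_tuples g n"
  by (auto simp: tuple_zero_def mat_tuples_def)

lemma tuple_conj_closed:
  "X \<in> mat_tuples g n \<Longrightarrow> P \<in> GL_pairs n \<Longrightarrow> tuple_conj P X \<in> mat_tuples g n"
  by (rule mat_tuplesI)
     (auto simp: tuple_conj_def mat_tuples_length GL_pairs_def
        intro!: mult_carrier_mat[where n = n] mat_tuples_nth)

lemma mat_dsum_closed:
  "A \<in> carrier_mat n n \<Longrightarrow> B \<in> carrier_mat m m \<Longrightarrow> mat_dsum A B \<in> carrier_mat (n + m) (n + m)"
  unfolding mat_dsum_def by (rule four_block_carrier_mat)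

lemma tuple_dsum_closed:
  "X \<in> mat_tuples g n \<Longrightarrow> Y \<in> mat_tuples g m \<Longrightarrow> tuple_dsum X Y \<in> mat_tuples g (n + m)"
  by (rule mat_tuplesI)
     (auto simp: tuple_dsum_def mat_tuples_length intro!: mat_dsum_closed mat_tuples_nth)

lemma append_closed:
  "X \<in> mat_tuples g n \<Longrightarrow> H \<in> mat_tuples g n \<Longrightarrow> X @ H \<in> mat_tuples (2 * g) n"
  by (auto simp: mat_tuples_def)

lemmas tuple_closed = tuple_add_closed tuple_smult_closed tuple_diff_closed tuple_zero_closed
  tuple_conj_closed tuple_dsum_closed append_closed

lemma entry_tuple_add:
  "X \<in> mat_tuples g n \<Longrightarrow> Y \<in> mat_tuples g n \<Longrightarrow> p \<in> tuple_index g n \<Longrightarrow>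
     entry (tuple_add X Y) p = entry X p + entry Y p"
  using mat_tuples_nth[of X g n "fst p"] mat_tuples_nth[of Y g n "fst p"]
  by (auto simp: tuple_index_def entry_def tuple_add_def mat_tuples_length)

lemma entry_tuple_diff:
  "X \<in> mat_tuples g n \<Longrightarrow> Y \<in> mat_tuples g n \<Longrightarrow> p \<in> tuple_index g n \<Longrightarrow>
     entry (tuple_diff X Y) p = entry X p - entry Y p"
  using mat_tuples_nth[of X g n "fst p"] mat_tuples_nth[of Y g n "fst p"]
  by (auto simp: tuple_index_def entry_def tuple_diff_def mat_tuples_length)

lemma entry_tuple_smult:
  "X \<in> mat_tuples g n \<Longrightarrow> p \<in> tuple_index g n \<Longrightarrow> entry (tuple_smult c X) p = c * entry X p"
  using mat_tuples_nth[of X g n "fst p"]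
  by (auto simp: tuple_index_def entry_def tuple_smult_def mat_tuples_length)

lemma tuple_line_closed:
  "X \<in> mat_tuples g n \<Longrightarrow> H \<in> mat_tuples g n \<Longrightarrow> tuple_add X (tuple_smult z H) \<in> mat_tuples g n"
  by (intro tuple_closed)

lemma entry_tuple_line:
  "X \<in> mat_tuples g n \<Longrightarrow> H \<in> mat_tuples g n \<Longrightarrow> p \<in> tuple_index g n \<Longrightarrow>
     entry (tuple_add X (tuple_smult z H)) p = entry X p + z * entry H p"
  by (simp add: entry_tuple_add[OF _ tuple_smult_closed] entry_tuple_smult)

text \<open>Each entry is a fixed linear combination of entries of \<open>X\<close>; in this form it
  can be differentiated term by term.\<close>

lemma entry_tuple_conj:
  assumes "X \<in> mat_tuples g n" "P \<in> GL_pairs n" "(k, i, j) \<in> tuple_index g n"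
  shows "entry (tuple_conj P X) (k, i, j) =
    (\<Sum>a<n. \<Sum>b<n. snd P $$ (i, a) * entry X (k, a, b) * fst P $$ (b, j))"
proof -
  have c: "X ! k \<in> carrier_mat n n" "fst P \<in> carrier_mat n n" "snd P \<in> carrier_mat n n"
    using assms by (auto simp: tuple_index_def GL_pairs_def intro: mat_tuples_nth)
  show ?thesis
    using c assms
    by (auto simp: tuple_index_def entry_def tuple_conj_def mat_tuples_length scalar_prod_def
        sum_distrib_left mult.assoc atLeast0LessThan intro!: sum.cong)
qed

lemma entry_tuple_dsum:
  assumes "X \<in> mat_tuples g n" "Y \<in> mat_tuples g m" "(k, i, j) \<in> tuple_index g (n + m)"
  shows "entry (tuple_dsum X Y) (k, i, j) =
    (if i < n \<and> j < n then entry X (k, i, j)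
     else if \<not> i < n \<and> \<not> j < n then entry Y (k, i - n, j - n) else 0)"
  using assms mat_tuples_nth[of X g n k] mat_tuples_nth[of Y g m k]
  by (auto simp: tuple_index_def entry_def tuple_dsum_def mat_tuples_length mat_dsum_def)

text \<open>The place in \<open>X @ H\<close>, for \<open>X\<close> of length \<open>g\<close>, of
  the entry of \<open>H\<close> at a given index.\<close>

definition shift_index :: "nat \<Rightarrow> nat \<times> nat \<times> nat \<Rightarrow> nat \<times> nat \<times> nat" where
  "shift_index g = (\<lambda>(k, i, j). (k + g, i, j))"

lemma shift_index_in: "p \<in> tuple_index g n \<Longrightarrow> shift_index g p \<in> tuple_index (2 * g) n"
  by (auto simp: tuple_index_def shift_index_def)

lemma tuple_index_double: "tuple_index g n \<subseteq> tuple_index (2 * g) n"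
  by (auto simp: tuple_index_def)

lemma entry_append:
  assumes "X \<in> mat_tuples g n" "p \<in> tuple_index g n"
  shows "entry (X @ H) p = entry X p" "entry (X @ H) (shift_index g p) = entry H p"
  using assms
  by (auto simp: tuple_index_def entry_def shift_index_def mat_tuples_length nth_append)

lemma tuple_append_simps:
  "length X = length Y \<Longrightarrow> tuple_add (X @ H) (Y @ K) = tuple_add X Y @ tuple_add H K"
  "tuple_smult c (X @ H) = tuple_smult c X @ tuple_smult c H"
  "tuple_conj P (X @ H) = tuple_conj P X @ tuple_conj P H"
  "length X = length Y \<Longrightarrow> tuple_dsum (X @ H) (Y @ K) = tuple_dsum X Y @ tuple_dsum H K"
  by (simp_all add: tuple_add_def tuple_smult_def tuple_conj_def tuple_dsum_def)

text \<open>Inverse of \<open>entry\<close> on valid indices; it turns a map of tuples into a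
  function of coordinates.\<close>

definition tuple_of :: "nat \<Rightarrow> nat \<Rightarrow> (nat \<times> nat \<times> nat \<Rightarrow> complex) \<Rightarrow> tuple" where
  "tuple_of g n x = map (\<lambda>k. mat n n (\<lambda>(i, j). x (k, i, j))) [0..<g]"

lemma tuple_of_closed: "tuple_of g n x \<in> mat_tuples g n"
  by (auto simp: tuple_of_def mat_tuples_def)

lemma entry_tuple_of: "p \<in> tuple_index g n \<Longrightarrow> entry (tuple_of g n x) p = x p"
  by (auto simp: tuple_of_def entry_def tuple_index_def)

section \<open>Derivatives of analytic tuple maps through local power series\<close>

lemma tuple_deriv_closed: "tuple_deriv h n \<phi> X H \<in> mat_tuples h n"
  unfolding tuple_deriv_def tuple_Lim_def by (rule tuple_of_closed[unfolded tuple_of_def])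

lemma entry_tuple_deriv:
  "q \<in> tuple_index h n \<Longrightarrow> entry (tuple_deriv h n \<phi> X H) q =
     Lim (at 0) (\<lambda>z. entry (tuple_smult (1 / z)
       (tuple_diff (\<phi> (tuple_add X (tuple_smult z H))) (\<phi> X))) q)"
  unfolding tuple_deriv_def tuple_Lim_def
  by (auto simp: tuple_index_def entry_def)

lemma tuple_add_smult_0: "X \<in> mat_tuples g n \<Longrightarrow> H \<in> mat_tuples g n \<Longrightarrow> tuple_add X (tuple_smult 0 H) = X"
  by (rule mat_tuples_eqI) (auto simp: entry_tuple_line intro!: tuple_line_closed)

text \<open>Finitely many strict inequalities, each continuous in \<open>z\<close>. The filter is
  \<open>nhds 0\<close>, including \<open>z = 0\<close>, because transferring a derivative between
  functions requires equality at the point itself.\<close>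

lemma polydisc_line:
  assumes "X \<in> polydisc g n W r" "H \<in> mat_tuples g n"
  shows "\<forall>\<^sub>F z in nhds 0. tuple_add X (tuple_smult z H) \<in> polydisc g n W r"
proof -
  have X: "X \<in> mat_tuples g n" using assms by (simp add: polydisc_def)
  have "\<forall>\<^sub>F z in nhds 0. \<forall>p\<in>tuple_index g n. cmod (entry X p + z * entry H p - entry W p) < r"
  proof (intro eventually_ball_finite ballI)
    fix p assume "p \<in> tuple_index g n"
    then have "cmod (entry X p + 0 * entry H p - entry W p) < r"
      using assms by (simp add: polydisc_def)
    moreover have "((\<lambda>z. cmod (entry X p + z * entry H p - entry W p)) \<longlongrightarrow>
        cmod (entry X p + 0 * entry H p - entry W p)) (nhds 0)"
      by (intro tendsto_intros filterlim_ident)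
    ultimately show "\<forall>\<^sub>F z in nhds 0. cmod (entry X p + z * entry H p - entry W p) < r"
      by (rule order_tendstoD(2)[rotated])
  qed simp
  then show ?thesis
    by eventually_elim
       (use X assms in \<open>auto simp: polydisc_def entry_tuple_line tuple_line_closed\<close>)
qed

lemma open_tuples_line:
  assumes "open_tuples g n U" "X \<in> U" "H \<in> mat_tuples g n"
  shows "\<forall>\<^sub>F z in nhds 0. tuple_add X (tuple_smult z H) \<in> U"
proof -
  obtain r where r: "r > 0" "polydisc g n X r \<subseteq> U" and X: "X \<in> mat_tuples g n"
    using assms(1,2) unfolding open_tuples_def by blast
  have "X \<in> polydisc g n X r" using r X by (simp add: polydisc_def)
  then show ?thesis
    using polydisc_line[OF _ assms(3)] r(2) by (blast intro: eventually_mono)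
qed

lemma DERIV_eventually_eq:
  assumes "\<forall>\<^sub>F z in nhds x. f z = g z" "(g has_field_derivative D) (at x)"
  shows "(f has_field_derivative D) (at x)"
  using DERIV_cong_ev[OF refl assms(1) refl] assms(2) by simp

text \<open>Links the limit in \<open>tuple_deriv\<close> to \<open>has_field_derivative\<close>.
  For small \<open>z\<close> the line stays in \<open>U\<close>, so the values of \<phi> are genuine
  tuples and taking entries commutes with forming the difference quotient.\<close>

lemma entry_tuple_derivI:
  assumes U: "open_tuples g n U" "X \<in> U" "H \<in> mat_tuples g n"
    and \<phi>: "\<phi> ` U \<subseteq> mat_tuples h n" and q: "q \<in> tuple_index h n"
    and D: "((\<lambda>z. entry (\<phi> (tuple_add X (tuple_smult z H))) q) has_field_derivative D) (at 0)"
  shows "entry (tuple_deriv h n \<phi> X H) q = D"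
proof -
  have X: "X \<in> mat_tuples g n" using U by (auto simp: open_tuples_def)
  have "((\<lambda>z. (entry (\<phi> (tuple_add X (tuple_smult z H))) q - entry (\<phi> X) q) / z) \<longlongrightarrow> D) (at 0)"
    using D unfolding DERIV_def by (simp add: tuple_add_smult_0[OF X U(3)])
  moreover have "\<forall>\<^sub>F z in at 0.
      (entry (\<phi> (tuple_add X (tuple_smult z H))) q - entry (\<phi> X) q) / z =
      entry (tuple_smult (1 / z) (tuple_diff (\<phi> (tuple_add X (tuple_smult z H))) (\<phi> X))) q"
  proof -
    have "\<forall>\<^sub>F z in at 0. tuple_add X (tuple_smult z H) \<in> U"
      using open_tuples_line[OF U] by (simp add: eventually_nhds_conv_at)
    then show ?thesis
      by eventually_elim
         (use \<phi>[THEN subsetD, OF imageI] U(2) q in \<open>simp add: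
            entry_tuple_smult[OF tuple_diff_closed[where g = h and n = n]]
            entry_tuple_diff[where g = h and n = n]\<close>)
  qed
  ultimately have "((\<lambda>z. entry (tuple_smult (1 / z)
        (tuple_diff (\<phi> (tuple_add X (tuple_smult z H))) (\<phi> X))) q)
      \<longlongrightarrow> D) (at 0)"
    by (rule Lim_transform_eventually)
  then show ?thesis
    unfolding entry_tuple_deriv[OF q] by (intro tendsto_Lim) auto
qed

text \<open>Analyticity gives convergence only at points of \<open>U\<close>. Once \<open>r\<close>
  is so small that the polydisc lies in \<open>U\<close>, every coordinate vector below
  \<open>r\<close> comes from a tuple in \<open>U\<close>, and the series converges on the full
  polydisc.\<close>

lemma analytic_tuple_map_local_series:
  assumes U: "open_tuples g n U" and \<phi>: "analytic_tuple_map g h n U \<phi>"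
    and W: "W \<in> U" and q: "q \<in> tuple_index h n"
  obtains r c G where "r > 0" "polydisc g n W r \<subseteq> U" "has_power_series (tuple_index g n) r c G"
    "\<And>X. X \<in> polydisc g n W r \<Longrightarrow> entry (\<phi> X) q = G (\<lambda>p. entry X p - entry W p)"
proof -
  obtain r1 where r1: "r1 > 0" "polydisc g n W r1 \<subseteq> U"
    using U W by (auto simp: open_tuples_def)
  obtain r2 c where r2: "r2 > 0" and c: "\<And>X. X \<in> U \<inter> polydisc g n W r2 \<Longrightarrow>
      ((\<lambda>\<alpha>. c \<alpha> * (\<Prod>p\<in>tuple_index g n. (entry X p - entry W p) ^ \<alpha> p)) has_sum entry (\<phi> X) q)
        (tuple_index g n \<rightarrow>\<^sub>E UNIV)"
    using \<phi> W q unfolding analytic_tuple_map_def by meson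
  define r where "r = min r1 r2"
  \<comment> \<open>The tuple whose displacement from \<open>W\<close> has coordinates
    \<open>x\<close>.\<close>
  define T where "T x = tuple_of g n (\<lambda>p. entry W p + x p)" for x
  have sub: "polydisc g n W r \<subseteq> polydisc g n W r1 \<inter> polydisc g n W r2"
    by (auto simp: polydisc_def r_def)
  show ?thesis
  proof
    show "r > 0" "polydisc g n W r \<subseteq> U" using r1 r2 sub by (auto simp: r_def)
    show "has_power_series (tuple_index g n) r c (\<lambda>x. entry (\<phi> (T x)) q)"
      unfolding has_power_series_def
    proof (intro allI impI)
      fix x assume x: "\<forall>p\<in>tuple_index g n. cmod (x p) < r"
      have "T x \<in> polydisc g n W r"
        using x by (auto simp: polydisc_def T_def entry_tuple_of tuple_of_closed)
      then have "((\<lambda>\<alpha>. c \<alpha> * (\<Prod>p\<in>tuple_index g n. (entry (T x) p - entry W p) ^ \<alpha> p))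
          has_sum entry (\<phi> (T x)) q) (tuple_index g n \<rightarrow>\<^sub>E UNIV)"
        using sub r1 by (intro c) auto
      moreover have "(\<Prod>p\<in>tuple_index g n. (entry (T x) p - entry W p) ^ \<alpha> p)
          = monom_at (tuple_index g n) \<alpha> x" for \<alpha>
        unfolding monom_at_def by (intro prod.cong) (auto simp: T_def entry_tuple_of)
      ultimately show "((\<lambda>\<alpha>. c \<alpha> * monom_at (tuple_index g n) \<alpha> x) has_sum entry (\<phi> (T x)) q)
          (multi_indices (tuple_index g n))"
        by (simp add: multi_indices_def)
    qed
    fix X assume "X \<in> polydisc g n W r"
    then have "T (\<lambda>p. entry X p - entry W p) = X"
      by (intro mat_tuples_eqI[of _ g n])
         (auto simp: T_def entry_tuple_of tuple_of_closed polydisc_def)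
    then show "entry (\<phi> X) q = entry (\<phi> (T (\<lambda>p. entry X p - entry W p))) q" by simp
  qed
qed

text \<open>The formula for the derivative holds on a whole polydisc, so it can be differentiated
  again. All \<open>G' p\<close> come from one coefficient family \<open>c\<close>, which is
  exported so that mixed second derivatives can be compared.\<close>

lemma analytic_tuple_map_local_deriv:
  assumes U: "open_tuples g n U" and \<phi>: "analytic_tuple_map g h n U \<phi>"
    and \<phi>_in: "\<phi> ` U \<subseteq> mat_tuples h n"
    and W: "W \<in> U" and q: "q \<in> tuple_index h n"
  obtains r c G' where "r > 0" "polydisc g n W r \<subseteq> U"
    "\<And>p. p \<in> tuple_index g n \<Longrightarrow> has_power_series (tuple_index g n) r (pderiv_coeff p c) (G' p)"
    "\<And>X H. X \<in> polydisc g n W r \<Longrightarrow> H \<in> mat_tuples g n \<Longrightarrow>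
       ((\<lambda>z. entry (\<phi> (tuple_add X (tuple_smult z H))) q) has_field_derivative
         entry (tuple_deriv h n \<phi> X H) q) (at 0)"
    "\<And>X H. X \<in> polydisc g n W r \<Longrightarrow> H \<in> mat_tuples g n \<Longrightarrow>
       entry (tuple_deriv h n \<phi> X H) q =
         (\<Sum>p\<in>tuple_index g n. entry H p * G' p (\<lambda>p. entry X p - entry W p))"
proof -
  let ?I = "tuple_index g n"
  obtain r c G where r: "r > 0" "polydisc g n W r \<subseteq> U" and G: "has_power_series ?I r c G"
    and G_eq: "\<And>X. X \<in> polydisc g n W r \<Longrightarrow> entry (\<phi> X) q = G (\<lambda>p. entry X p - entry W p)"
    using analytic_tuple_map_local_series[OF U \<phi> W q] by blast
  have "\<exists>G'. has_power_series ?I r (pderiv_coeff p c) G'" if "p \<in> ?I" for p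
    using has_power_series_pderiv[OF finite_tuple_index that G] by blast
  then obtain G' where G': "\<And>p. p \<in> ?I \<Longrightarrow> has_power_series ?I r (pderiv_coeff p c) (G' p)"
    by metis
  have D: "((\<lambda>z. entry (\<phi> (tuple_add X (tuple_smult z H))) q) has_field_derivative
      (\<Sum>p\<in>?I. entry H p * G' p (\<lambda>p. entry X p - entry W p))) (at 0)"
    if XH: "X \<in> polydisc g n W r" "H \<in> mat_tuples g n" for X H
  proof -
    let ?x = "\<lambda>p. entry X p - entry W p"
    have X: "X \<in> mat_tuples g n" and x: "\<And>p. p \<in> ?I \<Longrightarrow> cmod (?x p) < r"
      using XH by (auto simp: polydisc_def)
    have "\<forall>\<^sub>F z in nhds 0. entry (\<phi> (tuple_add X (tuple_smult z H))) q = G (\<lambda>p. ?x p + z * entry H p)"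
      using polydisc_line[OF XH]
    proof eventually_elim
      case (elim z)
      have "G (\<lambda>p. entry (tuple_add X (tuple_smult z H)) p - entry W p) = G (\<lambda>p. ?x p + z * entry H p)"
        using elim X XH
        by (intro has_power_series_local[OF G])
           (auto simp: polydisc_def entry_tuple_line)
      then show ?case using G_eq[OF elim] by simp
    qed
    moreover have "((\<lambda>z. G (\<lambda>p. ?x p + z * entry H p)) has_field_derivative
        (\<Sum>p\<in>?I. entry H p * G' p ?x)) (at 0)"
      by (rule has_power_series_line_deriv[OF finite_tuple_index G G' x])
    ultimately show ?thesis
      by (rule DERIV_eventually_eq)
  qed
  have E: "entry (tuple_deriv h n \<phi> X H) q = (\<Sum>p\<in>?I. entry H p * G' p (\<lambda>p. entry X p - entry W p))"
    if "X \<in> polydisc g n W r" "H \<in> mat_tuples g n" for X H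
    using entry_tuple_derivI[OF U _ that(2) \<phi>_in q D[OF that]] that r(2) by blast
  have D': "((\<lambda>z. entry (\<phi> (tuple_add X (tuple_smult z H))) q) has_field_derivative
      entry (tuple_deriv h n \<phi> X H) q) (at 0)"
    if "X \<in> polydisc g n W r" "H \<in> mat_tuples g n" for X H
    unfolding E[OF that] by (rule D[OF that])
  show ?thesis
    by (rule that[OF r]) (fact G' D' E)+
qed

lemma analytic_tuple_map_has_deriv:
  assumes "open_tuples g n U" and "analytic_tuple_map g h n U \<phi>"
    and "\<phi> ` U \<subseteq> mat_tuples h n"
    and "X \<in> U" and "q \<in> tuple_index h n" "H \<in> mat_tuples g n"
  shows "((\<lambda>z. entry (\<phi> (tuple_add X (tuple_smult z H))) q) has_field_derivative
           entry (tuple_deriv h n \<phi> X H) q) (at 0)"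
proof -
  obtain r where r: "r > 0" and *: "\<And>Y H. Y \<in> polydisc g n X r \<Longrightarrow> H \<in> mat_tuples g n \<Longrightarrow>
       ((\<lambda>z. entry (\<phi> (tuple_add Y (tuple_smult z H))) q) has_field_derivative
         entry (tuple_deriv h n \<phi> Y H) q) (at 0)"
    by (rule analytic_tuple_map_local_deriv[OF assms(1-5)]) (rule that)
  have "X \<in> polydisc g n X r"
    using assms(1,4) r by (auto simp: polydisc_def open_tuples_def)
  then show ?thesis using * assms(6) by blast
qed

text \<open>With the local series centred at \<open>X\<close>, each entry of the derivative at
  \<open>X\<close> is a linear form in the entries of the direction.\<close>

lemma tuple_deriv_linear:
  assumes U: "open_tuples g n U" and \<phi>: "analytic_tuple_map g h n U \<phi>"
    and \<phi>_in: "\<phi> ` U \<subseteq> mat_tuples h n" and X: "X \<in> U"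
    and H: "H \<in> mat_tuples g n" "K \<in> mat_tuples g n"
  shows "tuple_deriv h n \<phi> X (tuple_add (tuple_smult c H) K) =
    tuple_add (tuple_smult c (tuple_deriv h n \<phi> X H)) (tuple_deriv h n \<phi> X K)"
proof (rule mat_tuples_eqI)
  fix q assume q: "q \<in> tuple_index h n"
  obtain r G' where r: "r > 0" and E: "\<And>Y H. Y \<in> polydisc g n X r \<Longrightarrow> H \<in> mat_tuples g n \<Longrightarrow>
       entry (tuple_deriv h n \<phi> Y H) q =
         (\<Sum>p\<in>tuple_index g n. entry H p * G' p (\<lambda>p. entry Y p - entry X p))"
    by (rule analytic_tuple_map_local_deriv[OF U \<phi> \<phi>_in X q]) (rule that)
  have "X \<in> polydisc g n X r"
    using U X r by (auto simp: polydisc_def open_tuples_def)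
  note E = E[OF this]
  have "entry (tuple_deriv h n \<phi> X (tuple_add (tuple_smult c H) K)) q =
      (\<Sum>p\<in>tuple_index g n. (c * entry H p + entry K p) * G' p (\<lambda>p. entry X p - entry X p))"
    using H by (subst E) (auto simp: entry_tuple_add[OF tuple_smult_closed] entry_tuple_smult
        intro!: tuple_closed sum.cong)
  also have "\<dots> = c * entry (tuple_deriv h n \<phi> X H) q + entry (tuple_deriv h n \<phi> X K) q"
    unfolding E[OF H(1)] E[OF H(2)]
    by (simp only: sum_distrib_left distrib_right sum.distrib mult.assoc)
  also have "\<dots> = entry (tuple_add (tuple_smult c (tuple_deriv h n \<phi> X H)) (tuple_deriv h n \<phi> X K)) q"
    using q by (simp add: entry_tuple_smult[OF tuple_deriv_closed]
        entry_tuple_add[OF tuple_smult_closed[OF tuple_deriv_closed] tuple_deriv_closed])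
  finally show "entry (tuple_deriv h n \<phi> X (tuple_add (tuple_smult c H) K)) q =
      entry (tuple_add (tuple_smult c (tuple_deriv h n \<phi> X H)) (tuple_deriv h n \<phi> X K)) q" .
qed (auto intro!: tuple_closed tuple_deriv_closed)

section \<open>Compatibility of the derivative with similarities and direct sums\<close>

lemma tuple_conj_line:
  assumes "X \<in> mat_tuples g n" "H \<in> mat_tuples g n" "P \<in> GL_pairs n"
  shows "tuple_conj P (tuple_add X (tuple_smult z H)) =
    tuple_add (tuple_conj P X) (tuple_smult z (tuple_conj P H))"
proof (rule mat_tuples_eqI)
  fix p assume p: "p \<in> tuple_index g n"
  obtain k i j where kij: "p = (k, i, j)" by (cases p)
  have "(k, a, b) \<in> tuple_index g n" if "a < n" "b < n" for a b
    using p that by (auto simp: kij tuple_index_def)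
  then show "entry (tuple_conj P (tuple_add X (tuple_smult z H))) p =
      entry (tuple_add (tuple_conj P X) (tuple_smult z (tuple_conj P H))) p"
    using assms p unfolding kij
    by (simp add: entry_tuple_conj[where g = g and n = n] tuple_line_closed
        entry_tuple_line[where g = g and n = n]
        tuple_conj_closed sum_distrib_left distrib_left distrib_right sum.distrib mult_ac)
qed (use assms in \<open>auto intro!: tuple_closed\<close>)

text \<open>Conjugation carries lines to lines, so equivariance of \<phi> applies along the line
  while it stays in \<open>U\<close>. The conjugated values are fixed linear combinations of entries
  of \<phi>, whose derivatives exist by analyticity.\<close>

lemma tuple_deriv_conj:
  assumes U: "open_tuples g n U" and \<phi>: "analytic_tuple_map g h n U \<phi>"
    and \<phi>_in: "\<phi> ` U \<subseteq> mat_tuples h n" and P: "P \<in> GL_pairs n"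
    and conj: "\<And>Y. Y \<in> U \<Longrightarrow> tuple_conj P Y \<in> U"
      "\<And>Y. Y \<in> U \<Longrightarrow> \<phi> (tuple_conj P Y) = tuple_conj P (\<phi> Y)"
    and X: "X \<in> U" and H: "H \<in> mat_tuples g n"
  shows "tuple_deriv h n \<phi> (tuple_conj P X) (tuple_conj P H) = tuple_conj P (tuple_deriv h n \<phi> X H)"
proof (rule mat_tuples_eqI)
  fix q assume q: "q \<in> tuple_index h n"
  obtain k i j where kij: "q = (k, i, j)" by (cases q)
  have X': "X \<in> mat_tuples g n" using U X by (auto simp: open_tuples_def)
  have ix: "(k, a, b) \<in> tuple_index h n" if "a < n" "b < n" for a b
    using q that by (auto simp: kij tuple_index_def)
  let ?Q = "\<lambda>z. \<Sum>a<n. \<Sum>b<n.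
      snd P $$ (i, a) * entry (\<phi> (tuple_add X (tuple_smult z H))) (k, a, b) * fst P $$ (b, j)"
  let ?D = "\<Sum>a<n. \<Sum>b<n.
      snd P $$ (i, a) * entry (tuple_deriv h n \<phi> X H) (k, a, b) * fst P $$ (b, j)"
  have "\<forall>\<^sub>F z in nhds 0. entry (\<phi> (tuple_add (tuple_conj P X) (tuple_smult z (tuple_conj P H)))) q =
      ?Q z"
    using open_tuples_line[OF U X H]
  proof eventually_elim
    case (elim z)
    then show ?case
      using q P by (simp add: entry_tuple_conj[OF \<phi>_in[THEN subsetD, OF imageI]] conj(2) kij
          flip: tuple_conj_line[OF X' H P])
  qed
  moreover have "(?Q has_field_derivative ?D) (at 0)"
    using ix
    by (intro DERIV_sum DERIV_cmult DERIV_cmult_right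
        analytic_tuple_map_has_deriv[OF U \<phi> \<phi>_in X _ H]) auto
  ultimately have "((\<lambda>z. entry (\<phi> (tuple_add (tuple_conj P X) (tuple_smult z (tuple_conj P H)))) q)
      has_field_derivative ?D) (at 0)"
    by (rule DERIV_eventually_eq)
  from entry_tuple_derivI[OF U conj(1)[OF X] tuple_conj_closed[OF H P] \<phi>_in q this]
  show "entry (tuple_deriv h n \<phi> (tuple_conj P X) (tuple_conj P H)) q =
      entry (tuple_conj P (tuple_deriv h n \<phi> X H)) q"
    using q by (simp add: kij entry_tuple_conj[OF tuple_deriv_closed P])
qed (use P in \<open>auto intro!: tuple_closed tuple_deriv_closed\<close>)

lemma tuple_dsum_line:
  assumes "X \<in> mat_tuples g n" "H \<in> mat_tuples g n" "Y \<in> mat_tuples g m" "K \<in> mat_tuples g m"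
  shows "tuple_dsum (tuple_add X (tuple_smult z H)) (tuple_add Y (tuple_smult z K)) =
    tuple_add (tuple_dsum X Y) (tuple_smult z (tuple_dsum H K))"
proof (rule mat_tuples_eqI)
  fix p assume p: "p \<in> tuple_index g (n + m)"
  obtain k i j where kij: "p = (k, i, j)" by (cases p)
  have "i < n \<Longrightarrow> j < n \<Longrightarrow> (k, i, j) \<in> tuple_index g n"
    "\<not> i < n \<Longrightarrow> \<not> j < n \<Longrightarrow> (k, i - n, j - n) \<in> tuple_index g m"
    using p by (auto simp: kij tuple_index_def)
  then show "entry (tuple_dsum (tuple_add X (tuple_smult z H)) (tuple_add Y (tuple_smult z K))) p =
      entry (tuple_add (tuple_dsum X Y) (tuple_smult z (tuple_dsum H K))) p"
    using assms p unfolding kij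
    by (simp add: entry_tuple_dsum[where g = g and n = n and m = m] tuple_line_closed
        entry_tuple_line[where g = g and n = "n + m"] entry_tuple_line[where g = g and n = n]
        entry_tuple_line[where g = g and n = m] tuple_dsum_closed)
qed (use assms in \<open>auto intro!: tuple_closed\<close>)

text \<open>The maps \<phi>, \<psi> and \<theta> stand for the levels \<open>n\<close>,
  \<open>m\<close> and \<open>n + m\<close> of a free map. Along the line of direct sums the
  derivative of \<theta> is read off the two diagonal blocks, the off-diagonal ones being constantly
  0.\<close>

lemma tuple_deriv_dsum:
  assumes U: "open_tuples g n U" and \<phi>: "analytic_tuple_map g h n U \<phi>"
    and \<phi>_in: "\<phi> ` U \<subseteq> mat_tuples h n"
    and V: "open_tuples g m V" and \<psi>: "analytic_tuple_map g h m V \<psi>"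
    and \<psi>_in: "\<psi> ` V \<subseteq> mat_tuples h m"
    and T: "open_tuples g (n + m) T" and \<theta>_in: "\<theta> ` T \<subseteq> mat_tuples h (n + m)"
    and dsum: "\<And>Z Z'. Z \<in> U \<Longrightarrow> Z' \<in> V \<Longrightarrow> tuple_dsum Z Z' \<in> T"
      "\<And>Z Z'. Z \<in> U \<Longrightarrow> Z' \<in> V \<Longrightarrow> \<theta> (tuple_dsum Z Z') = tuple_dsum (\<phi> Z) (\<psi> Z')"
    and X: "X \<in> U" and H: "H \<in> mat_tuples g n" and Y: "Y \<in> V" and K: "K \<in> mat_tuples g m"
  shows "tuple_deriv h (n + m) \<theta> (tuple_dsum X Y) (tuple_dsum H K) =
    tuple_dsum (tuple_deriv h n \<phi> X H) (tuple_deriv h m \<psi> Y K)"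
proof (rule mat_tuples_eqI)
  fix q assume q: "q \<in> tuple_index h (n + m)"
  obtain k i j where kij: "q = (k, i, j)" by (cases q)
  have XY: "X \<in> mat_tuples g n" "Y \<in> mat_tuples g m"
    using U X V Y by (auto simp: open_tuples_def)
  let ?L = "\<lambda>z. entry (\<phi> (tuple_add X (tuple_smult z H))) (k, i, j)"
  let ?R = "\<lambda>z. entry (\<psi> (tuple_add Y (tuple_smult z K))) (k, i - n, j - n)"
  have "\<forall>\<^sub>F z in nhds 0. entry (\<theta> (tuple_add (tuple_dsum X Y) (tuple_smult z (tuple_dsum H K)))) q =
      (if i < n \<and> j < n then ?L z else if \<not> i < n \<and> \<not> j < n then ?R z else 0)"
    using open_tuples_line[OF U X H] open_tuples_line[OF V Y K]
  proof eventually_elim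
    case (elim z)
    then show ?case
      using q by (simp add: dsum(2) kij
          entry_tuple_dsum[OF \<phi>_in[THEN subsetD, OF imageI] \<psi>_in[THEN subsetD, OF imageI]]
          flip: tuple_dsum_line[OF XY(1) H XY(2) K])
  qed
  moreover have "((\<lambda>z. if i < n \<and> j < n then ?L z else if \<not> i < n \<and> \<not> j < n then ?R z else 0)
      has_field_derivative (if i < n \<and> j < n then entry (tuple_deriv h n \<phi> X H) (k, i, j)
        else if \<not> i < n \<and> \<not> j < n then entry (tuple_deriv h m \<psi> Y K) (k, i - n, j - n) else 0)) (at 0)"
  proof -
    have "i < n \<Longrightarrow> j < n \<Longrightarrow> (k, i, j) \<in> tuple_index h n"
      "\<not> i < n \<Longrightarrow> \<not> j < n \<Longrightarrow> (k, i - n, j - n) \<in> tuple_index h m"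
      using q by (auto simp: kij tuple_index_def)
    then show ?thesis
      using analytic_tuple_map_has_deriv[OF U \<phi> \<phi>_in X _ H]
        analytic_tuple_map_has_deriv[OF V \<psi> \<psi>_in Y _ K]
      by simp
  qed
  ultimately have "((\<lambda>z. entry (\<theta> (tuple_add (tuple_dsum X Y) (tuple_smult z (tuple_dsum H K)))) q)
      has_field_derivative (if i < n \<and> j < n then entry (tuple_deriv h n \<phi> X H) (k, i, j)
        else if \<not> i < n \<and> \<not> j < n then entry (tuple_deriv h m \<psi> Y K) (k, i - n, j - n) else 0)) (at 0)"
    by (rule DERIV_eventually_eq)
  from entry_tuple_derivI[OF T dsum(1)[OF X Y] tuple_dsum_closed[OF H K] \<theta>_in q this]
  show "entry (tuple_deriv h (n + m) \<theta> (tuple_dsum X Y) (tuple_dsum H K)) q =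
      entry (tuple_dsum (tuple_deriv h n \<phi> X H) (tuple_deriv h m \<psi> Y K)) q"
    using q by (simp add: kij entry_tuple_dsum[OF tuple_deriv_closed tuple_deriv_closed])
qed (auto intro!: tuple_closed tuple_deriv_closed)

section \<open>The domain of pairs and analyticity of the derivative on it\<close>

text \<open>A polydisc about \<open>X @ H\<close> splits into polydiscs about \<open>X\<close> and
  \<open>H\<close>; membership restricts only the first half.\<close>

lemma open_times_all:
  assumes "open_tuples g n (\<Omega> n)"
  shows "open_tuples (2 * g) n (times_all g \<Omega> n)"
  unfolding open_tuples_def
proof (intro conjI ballI)
  have sub: "\<Omega> n \<subseteq> mat_tuples g n" using assms by (simp add: open_tuples_def)
  then show "times_all g \<Omega> n \<subseteq> mat_tuples (2 * g) n"
    by (auto simp: times_all_def intro: append_closed)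
  fix W assume "W \<in> times_all g \<Omega> n"
  then obtain X H where W: "W = X @ H" and X: "X \<in> \<Omega> n" and H: "H \<in> mat_tuples g n"
    by (auto simp: times_all_def)
  obtain r where r: "r > 0" "polydisc g n X r \<subseteq> \<Omega> n"
    using assms X unfolding open_tuples_def by blast
  have "polydisc (2 * g) n W r \<subseteq> times_all g \<Omega> n"
  proof
    fix Z assume Z: "Z \<in> polydisc (2 * g) n W r"
    then have len: "length Z = 2 * g" and "Z \<in> mat_tuples (2 * g) n"
      by (auto simp: polydisc_def mat_tuples_length)
    then have cl: "take g Z \<in> mat_tuples g n" "drop g Z \<in> mat_tuples g n"
      by (auto simp: mat_tuples_def dest: in_set_takeD in_set_dropD)
    moreover have "take g Z \<in> polydisc g n X r"
      unfolding polydisc_def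
    proof (intro CollectI conjI ballI cl)
      fix p assume p: "p \<in> tuple_index g n"
      then have "cmod (entry Z p - entry W p) < r"
        using Z tuple_index_double by (auto simp: polydisc_def)
      moreover have "entry Z p = entry (take g Z) p"
        using entry_append(1)[OF cl(1) p, of "drop g Z"] by simp
      moreover have "entry W p = entry X p"
        using X sub p by (auto simp: W entry_append)
      ultimately show "cmod (entry (take g Z) p - entry X p) < r" by simp
    qed
    ultimately have "take g Z \<in> \<Omega> n" "drop g Z \<in> mat_tuples g n" using r by auto
    then show "Z \<in> times_all g \<Omega> n"
      unfolding times_all_def using append_take_drop_id[of g Z]
      by (metis (mono_tags, lifting) mem_Collect_eq)
  qed
  then show "\<exists>r>0. polydisc (2 * g) n W r \<subseteq> times_all g \<Omega> n" using r by blast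
qed

lemma polydisc_appendD:
  assumes "X @ H \<in> polydisc (2 * g) n (W @ H0) r" "X \<in> mat_tuples g n" "W \<in> mat_tuples g n"
  shows "X \<in> polydisc g n W r"
  unfolding polydisc_def
proof (intro CollectI conjI ballI)
  fix p assume p: "p \<in> tuple_index g n"
  then have "cmod (entry (X @ H) p - entry (W @ H0) p) < r"
    using assms(1) tuple_index_double by (auto simp: polydisc_def)
  then show "cmod (entry X p - entry W p) < r"
    using assms p by (simp add: entry_append)
qed (use assms in simp)

text \<open>The local formula is linear in \<open>H\<close>, whereas a power series about
  \<open>X0 @ H0\<close> needs centred coordinates. Splitting \<open>H\<close> into
  \<open>H0\<close> and an increment turns each summand into a constant times \<open>G' p\<close>
  plus a variable times \<open>G' p\<close>.\<close>

lemma analytic_tuple_deriv: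
  assumes U: "open_tuples g n (\<Omega> n)" and \<phi>: "analytic_tuple_map g h n (\<Omega> n) \<phi>"
    and \<phi>_in: "\<phi> ` \<Omega> n \<subseteq> mat_tuples h n"
    and T: "\<And>X H. X \<in> \<Omega> n \<Longrightarrow> H \<in> mat_tuples g n \<Longrightarrow> T (X @ H) = tuple_deriv h n \<phi> X H"
  shows "analytic_tuple_map (2 * g) h n (times_all g \<Omega> n) T"
  unfolding analytic_tuple_map_def
proof (intro ballI)
  fix W q assume "W \<in> times_all g \<Omega> n" and q: "q \<in> tuple_index h n"
  then obtain X0 H0 where W: "W = X0 @ H0" and X0: "X0 \<in> \<Omega> n" and H0: "H0 \<in> mat_tuples g n"
    by (auto simp: times_all_def)
  let ?I = "tuple_index g n" and ?J = "tuple_index (2 * g) n"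
  have sub: "\<Omega> n \<subseteq> mat_tuples g n" using U by (simp add: open_tuples_def)
  obtain r c G' where r: "r > 0"
    and G': "\<And>p. p \<in> ?I \<Longrightarrow> has_power_series ?I r (pderiv_coeff p c) (G' p)"
    and E: "\<And>X H. X \<in> polydisc g n X0 r \<Longrightarrow> H \<in> mat_tuples g n \<Longrightarrow>
       entry (tuple_deriv h n \<phi> X H) q = (\<Sum>p\<in>?I. entry H p * G' p (\<lambda>p. entry X p - entry X0 p))"
    by (rule analytic_tuple_map_local_deriv[OF U \<phi> \<phi>_in X0 q]) (rule that)
  have "\<exists>d. has_power_series ?J r d (\<lambda>x. entry H0 p * G' p x + x (shift_index g p) * G' p x)"
    if p: "p \<in> ?I" for p
  proof -
    obtain d where d: "has_power_series ?J r d (G' p)"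
      using has_power_series_extend[OF finite_tuple_index tuple_index_double G'[OF p]] by blast
    show ?thesis
      using has_power_series_add[OF has_power_series_cmult[OF d]
          has_power_series_times_var[OF finite_tuple_index shift_index_in[OF p] d]] by blast
  qed
  then have "\<exists>d. \<forall>p\<in>?I.
      has_power_series ?J r (d p) (\<lambda>x. entry H0 p * G' p x + x (shift_index g p) * G' p x)"
    by (intro bchoice) blast
  then obtain d where "\<And>p. p \<in> ?I \<Longrightarrow>
      has_power_series ?J r (d p) (\<lambda>x. entry H0 p * G' p x + x (shift_index g p) * G' p x)"
    by blast
  then have S: "has_power_series ?J r (\<lambda>\<alpha>. \<Sum>p\<in>?I. d p \<alpha>)
      (\<lambda>x. \<Sum>p\<in>?I. entry H0 p * G' p x + x (shift_index g p) * G' p x)"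
    by (intro has_power_series_sum) auto
  have "((\<lambda>\<alpha>. (\<Sum>p\<in>?I. d p \<alpha>) * (\<Prod>p\<in>?J. (entry Z p - entry W p) ^ \<alpha> p)) has_sum entry (T Z) q)
      (?J \<rightarrow>\<^sub>E UNIV)" if Z: "Z \<in> times_all g \<Omega> n \<inter> polydisc (2 * g) n W r" for Z
  proof -
    obtain X H where ZXH: "Z = X @ H" and X: "X \<in> \<Omega> n" and H: "H \<in> mat_tuples g n"
      using Z by (auto simp: times_all_def)
    have X': "X \<in> mat_tuples g n" "X0 \<in> mat_tuples g n" using X X0 sub by auto
    have XP: "X \<in> polydisc g n X0 r"
      using Z X' by (intro polydisc_appendD[of X H g n X0 H0]) (auto simp: ZXH W)
    let ?x = "\<lambda>p. entry Z p - entry W p"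
    have "(\<Sum>p\<in>?I. entry H0 p * G' p ?x + ?x (shift_index g p) * G' p ?x) = entry (T Z) q"
    proof -
      have "entry H0 p * G' p ?x + ?x (shift_index g p) * G' p ?x =
          entry H p * G' p (\<lambda>p. entry X p - entry X0 p)" if p: "p \<in> ?I" for p
      proof -
        \<comment> \<open>\<open>G' p\<close> depends only on coordinates in \<open>?I\<close>,
          where the entries of the pairs are those of their first halves.\<close>
        have x: "G' p ?x = G' p (\<lambda>p. entry X p - entry X0 p)"
          using XP X' by (intro has_power_series_local[OF G'[OF p]])
            (auto simp: polydisc_def ZXH W entry_append)
        have "?x (shift_index g p) = entry H p - entry H0 p"
          using X' p by (simp add: ZXH W entry_append)
        then show ?thesis by (simp only: x flip: distrib_right) simp
      qed
      then show ?thesis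
        using E[OF XP H] T[OF X H] by (simp add: ZXH)
    qed
    moreover have "((\<lambda>\<alpha>. (\<Sum>p\<in>?I. d p \<alpha>) * monom_at ?J \<alpha> ?x) has_sum
        (\<Sum>p\<in>?I. entry H0 p * G' p ?x + ?x (shift_index g p) * G' p ?x)) (multi_indices ?J)"
      using Z by (intro has_power_seriesD[OF S]) (auto simp: polydisc_def)
    ultimately show ?thesis by (simp add: monom_at_def multi_indices_def)
  qed
  then show "\<exists>r>0. \<exists>c. \<forall>Z\<in>times_all g \<Omega> n \<inter> polydisc (2 * g) n W r.
      ((\<lambda>\<alpha>. c \<alpha> * (\<Prod>p\<in>?J. (entry Z p - entry W p) ^ \<alpha> p)) has_sum entry (T Z) q) (?J \<rightarrow>\<^sub>E UNIV)"
    using r by (intro exI[of _ r] exI[of _ "\<lambda>\<alpha>. \<Sum>p\<in>?I. d p \<alpha>"] conjI ballI)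
qed

section \<open>Second derivatives and their symmetry\<close>

text \<open>The product rule is applied to the local formula along the line through
  \<open>(X, H)\<close> in direction \<open>(K, L)\<close>. The coefficients \<open>d1\<close> and
  \<open>d2\<close> are chosen before \<open>H\<close>, \<open>K\<close> and \<open>L\<close>, so
  the same ones serve after \<open>H\<close> and \<open>K\<close> are exchanged.\<close>

lemma tuple_deriv_deriv:
  assumes U: "open_tuples g n (\<Omega> n)" and \<phi>: "analytic_tuple_map g h n (\<Omega> n) \<phi>"
    and \<phi>_in: "\<phi> ` \<Omega> n \<subseteq> mat_tuples h n"
    and T: "\<And>X H. X \<in> \<Omega> n \<Longrightarrow> H \<in> mat_tuples g n \<Longrightarrow> T (X @ H) = tuple_deriv h n \<phi> X H"
    and X: "X \<in> \<Omega> n" and q: "q \<in> tuple_index h n"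
  obtains d1 d2 where
    "\<And>p p'. p \<in> tuple_index g n \<Longrightarrow> p' \<in> tuple_index g n \<Longrightarrow> d2 p p' = d2 p' p"
    "\<And>H K L. H \<in> mat_tuples g n \<Longrightarrow> K \<in> mat_tuples g n \<Longrightarrow> L \<in> mat_tuples g n \<Longrightarrow>
       entry (tuple_deriv h n T (X @ H) (K @ L)) q =
         (\<Sum>p\<in>tuple_index g n. entry L p * d1 p) +
         (\<Sum>p\<in>tuple_index g n. \<Sum>p'\<in>tuple_index g n. entry H p * entry K p' * d2 p p')"
proof -
  let ?I = "tuple_index g n"
  have X': "X \<in> mat_tuples g n" using U X by (auto simp: open_tuples_def)
  obtain r c G' where r: "r > 0" "polydisc g n X r \<subseteq> \<Omega> n"
    and G': "\<And>p. p \<in> ?I \<Longrightarrow> has_power_series ?I r (pderiv_coeff p c) (G' p)"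
    and E: "\<And>Y H. Y \<in> polydisc g n X r \<Longrightarrow> H \<in> mat_tuples g n \<Longrightarrow>
       entry (tuple_deriv h n \<phi> Y H) q = (\<Sum>p\<in>?I. entry H p * G' p (\<lambda>p. entry Y p - entry X p))"
    by (rule analytic_tuple_map_local_deriv[OF U \<phi> \<phi>_in X q]) (rule that)
  have "\<exists>G''. has_power_series ?I r (pderiv_coeff p' (pderiv_coeff p c)) G''"
    if "p \<in> ?I" "p' \<in> ?I" for p p'
    using has_power_series_pderiv[OF finite_tuple_index that(2) G'[OF that(1)]] by blast
  then obtain G'' where G'': "\<And>p p'. p \<in> ?I \<Longrightarrow> p' \<in> ?I \<Longrightarrow>
      has_power_series ?I r (pderiv_coeff p' (pderiv_coeff p c)) (G'' p p')"
    by metis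
  have XP: "X \<in> polydisc g n X r" using r X' by (simp add: polydisc_def)
  show ?thesis
  proof
    fix p p' assume p: "p \<in> ?I" "p' \<in> ?I"
    show "G'' p p' (\<lambda>_. 0) = G'' p' p (\<lambda>_. 0)"
      \<comment> \<open>Both functions are sums of one and the same series, because the coefficient
        operators commute.\<close>
      using has_power_series_unique[OF G''[OF p] G''[OF p(2,1), unfolded pderiv_coeff_commute[of p]]] r
      by simp
  next
    fix H K L assume HKL: "H \<in> mat_tuples g n" "K \<in> mat_tuples g n" "L \<in> mat_tuples g n"
    \<comment> \<open>The series is centred at \<open>X\<close>, so the displacement at time
      \<open>z\<close> is \<open>z * entry K p\<close>. The \<open>0 +\<close> is kept to match the
      shape \<open>x p + z * y p\<close> required by
      \<open>has_power_series_line_deriv\<close>.\<close>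
    have "\<forall>\<^sub>F z in nhds 0. entry (T (tuple_add (X @ H) (tuple_smult z (K @ L)))) q =
        (\<Sum>p\<in>?I. (entry H p + z * entry L p) * G' p (\<lambda>p. 0 + z * entry K p))"
      using polydisc_line[OF XP HKL(2)]
    proof eventually_elim
      case (elim z)
      have "T (tuple_add (X @ H) (tuple_smult z (K @ L))) =
          tuple_deriv h n \<phi> (tuple_add X (tuple_smult z K)) (tuple_add H (tuple_smult z L))"
        using elim r HKL X'
        by (simp add: tuple_append_simps mat_tuples_length[where g = g and n = n] tuple_smult_closed
            T subset_iff tuple_line_closed)
      moreover have "G' p (\<lambda>p. entry (tuple_add X (tuple_smult z K)) p - entry X p) =
          G' p (\<lambda>p. 0 + z * entry K p)" if "p \<in> ?I" for p
        using elim X' HKL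
        by (intro has_power_series_local[OF G'[OF that]]) (auto simp: polydisc_def entry_tuple_line)
      ultimately show ?case
        using E[OF elim tuple_line_closed[OF HKL(1,3)]] HKL by (simp add: entry_tuple_line)
    qed
    moreover have "((\<lambda>z. \<Sum>p\<in>?I. (entry H p + z * entry L p) * G' p (\<lambda>p. 0 + z * entry K p))
        has_field_derivative
        (\<Sum>p\<in>?I. entry L p * G' p (\<lambda>_. 0) + entry H p * (\<Sum>p'\<in>?I. entry K p' * G'' p p' (\<lambda>_. 0)))) (at 0)"
    proof (rule DERIV_sum)
      fix p assume p: "p \<in> ?I"
      have D1: "((\<lambda>z. G' p (\<lambda>p. 0 + z * entry K p)) has_field_derivative
          (\<Sum>p'\<in>?I. entry K p' * G'' p p' (\<lambda>_. 0))) (at 0)"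
        using r by (intro has_power_series_line_deriv[OF finite_tuple_index G'[OF p] G''[OF p]]) auto
      have D2: "((\<lambda>z. entry H p + z * entry L p) has_field_derivative entry L p) (at 0)"
        by (auto intro!: derivative_eq_intros)
      show "((\<lambda>z. (entry H p + z * entry L p) * G' p (\<lambda>p. 0 + z * entry K p))
          has_field_derivative
          entry L p * G' p (\<lambda>_. 0) + entry H p * (\<Sum>p'\<in>?I. entry K p' * G'' p p' (\<lambda>_. 0))) (at 0)"
        using DERIV_mult[OF D2 D1] by (simp add: mult.commute)
    qed
    ultimately have D: "((\<lambda>z. entry (T (tuple_add (X @ H) (tuple_smult z (K @ L)))) q) has_field_derivative
        (\<Sum>p\<in>?I. entry L p * G' p (\<lambda>_. 0) + entry H p * (\<Sum>p'\<in>?I. entry K p' * G'' p p' (\<lambda>_. 0)))) (at 0)"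
      by (rule DERIV_eventually_eq)
    have "entry (tuple_deriv h n T (X @ H) (K @ L)) q =
        (\<Sum>p\<in>?I. entry L p * G' p (\<lambda>_. 0) + entry H p * (\<Sum>p'\<in>?I. entry K p' * G'' p p' (\<lambda>_. 0)))"
    proof (rule entry_tuple_derivI[OF open_times_all[where \<Omega> = \<Omega> and n = n, OF U] _ _ _ q D])
      show "X @ H \<in> times_all g \<Omega> n" "K @ L \<in> mat_tuples (2 * g) n"
        using X HKL by (auto simp: times_all_def intro: append_closed)
      show "T ` times_all g \<Omega> n \<subseteq> mat_tuples h n"
        using T by (auto simp: times_all_def intro!: tuple_deriv_closed)
    qed
    then show "entry (tuple_deriv h n T (X @ H) (K @ L)) q =
         (\<Sum>p\<in>?I. entry L p * G' p (\<lambda>_. 0)) +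
         (\<Sum>p\<in>?I. \<Sum>p'\<in>?I. entry H p * entry K p' * G'' p p' (\<lambda>_. 0))"
      by (simp add: sum.distrib sum_distrib_left mult.assoc)
  qed
qed

text \<open>Exchanging the two summations and using the symmetry of \<open>d2\<close> swaps
  \<open>H\<close> and \<open>K\<close> in the quadratic term; the term in \<open>L\<close> involves
  neither.\<close>

lemma tuple_deriv_deriv_symmetric:
  assumes U: "open_tuples g n (\<Omega> n)" and \<phi>: "analytic_tuple_map g h n (\<Omega> n) \<phi>"
    and \<phi>_in: "\<phi> ` \<Omega> n \<subseteq> mat_tuples h n"
    and T: "\<And>X H. X \<in> \<Omega> n \<Longrightarrow> H \<in> mat_tuples g n \<Longrightarrow> T (X @ H) = tuple_deriv h n \<phi> X H"
    and X: "X \<in> \<Omega> n" and HKL: "H \<in> mat_tuples g n" "K \<in> mat_tuples g n" "L \<in> mat_tuples g n"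
  shows "tuple_deriv h n T (X @ H) (K @ L) = tuple_deriv h n T (X @ K) (H @ L)"
proof (rule mat_tuples_eqI)
  fix q assume q: "q \<in> tuple_index h n"
  let ?I = "tuple_index g n"
  obtain d1 d2 where sym: "\<And>p p'. p \<in> ?I \<Longrightarrow> p' \<in> ?I \<Longrightarrow> d2 p p' = d2 p' p"
    and D: "\<And>H K L. H \<in> mat_tuples g n \<Longrightarrow> K \<in> mat_tuples g n \<Longrightarrow> L \<in> mat_tuples g n \<Longrightarrow>
       entry (tuple_deriv h n T (X @ H) (K @ L)) q =
         (\<Sum>p\<in>?I. entry L p * d1 p) + (\<Sum>p\<in>?I. \<Sum>p'\<in>?I. entry H p * entry K p' * d2 p p')"
    by (rule tuple_deriv_deriv[where \<Omega> = \<Omega> and n = n and T = T, OF U \<phi> \<phi>_in T X q])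
      (assumption | rule that)+
  have "(\<Sum>p\<in>?I. \<Sum>p'\<in>?I. entry H p * entry K p' * d2 p p') =
      (\<Sum>p\<in>?I. \<Sum>p'\<in>?I. entry K p * entry H p' * d2 p p')"
    by (subst sum.swap) (auto intro!: sum.cong simp: sym mult_ac)
  then show "entry (tuple_deriv h n T (X @ H) (K @ L)) q = entry (tuple_deriv h n T (X @ K) (H @ L)) q"
    using HKL by (simp add: D)
qed (rule tuple_deriv_closed)+

section \<open>The derivative of an analytic free map as a free-curl free vector field\<close>

theorem theorem2p4:
  fixes g h :: nat
    and \<Omega> :: "nat \<Rightarrow> tuple set"
    and f F :: "nat \<Rightarrow> tuple \<Rightarrow> tuple"
  assumes "g \<ge> 1" and "h \<ge> 1"
    and "free_domain g \<Omega>"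
    and "free_map h \<Omega> f" and "analytic_map g h \<Omega> f"
    and "\<And>n X H. n \<ge> 1 \<Longrightarrow> X \<in> \<Omega> n \<Longrightarrow> H \<in> mat_tuples g n \<Longrightarrow>
           F n (X @ H) = tuple_deriv h n (f n) X H"
  shows "analytic_free_vector_field g h \<Omega> F \<and>
         free_curl_free g h \<Omega> F \<and>
         (\<forall>n \<ge> 1. \<forall>X \<in> \<Omega> n. \<forall>H \<in> mat_tuples g n. \<forall>K \<in> mat_tuples g n. \<forall>L \<in> mat_tuples g n.
            tuple_deriv h n (F n) (X @ H) (K @ L) = tuple_deriv h n (F n) (X @ K) (H @ L))"
proof -
  note F = assms(6)
  have U: "open_tuples g n (\<Omega> n)" if "n \<ge> 1" for n
    using assms(3) that by (simp add: free_domain_def)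
  then have sub: "X \<in> mat_tuples g n" if "n \<ge> 1" "X \<in> \<Omega> n" for n X
    using that by (auto simp: open_tuples_def)
  have an: "analytic_tuple_map g h n (\<Omega> n) (f n)" if "n \<ge> 1" for n
    using assms(5) that by (simp add: analytic_map_def)
  have f_in: "f n ` \<Omega> n \<subseteq> mat_tuples h n" if "n \<ge> 1" for n
    using assms(4) that by (auto simp: free_map_def)
  have dsum: "tuple_dsum X Y \<in> \<Omega> (n + m)" "f (n + m) (tuple_dsum X Y) = tuple_dsum (f n X) (f m Y)"
    if "n \<ge> 1" "m \<ge> 1" "X \<in> \<Omega> n" "Y \<in> \<Omega> m" for n m X Y
    using assms(3,4) that by (simp_all add: free_domain_def free_set_def free_map_def)
  have conj: "tuple_conj P X \<in> \<Omega> n" "f n (tuple_conj P X) = tuple_conj P (f n X)"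
    if "n \<ge> 1" "P \<in> GL_pairs n" "X \<in> \<Omega> n" for n P X
    using assms(3,4) that by (simp_all add: free_domain_def free_set_def free_map_def)
  have symmetric: "tuple_deriv h n (F n) (X @ H) (K @ L) = tuple_deriv h n (F n) (X @ K) (H @ L)"
    if n: "n \<ge> 1" and "X \<in> \<Omega> n" "H \<in> mat_tuples g n" "K \<in> mat_tuples g n" "L \<in> mat_tuples g n"
    for n X H K L
    by (rule tuple_deriv_deriv_symmetric[where \<Omega> = \<Omega> and n = n and T = "F n",
          OF U[OF n] an[OF n] f_in[OF n] F[OF n]]) (use that in auto)
  have "free_map h (times_all g \<Omega>) F"
    unfolding free_map_def
  proof (intro conjI allI impI ballI)
    fix n Z assume "1 \<le> n" "Z \<in> times_all g \<Omega> n"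
    then show "F n Z \<in> mat_tuples h n"
      by (auto simp: times_all_def F intro: tuple_deriv_closed)
  next
    fix n m Z Z' assume n: "1 \<le> n" and m: "1 \<le> m" and "Z \<in> times_all g \<Omega> n" "Z' \<in> times_all g \<Omega> m"
    then obtain X H Y K where Z: "Z = X @ H" "Z' = Y @ K" and X: "X \<in> \<Omega> n" "H \<in> mat_tuples g n"
      and Y: "Y \<in> \<Omega> m" "K \<in> mat_tuples g m"
      by (auto simp: times_all_def)
    have nm: "1 \<le> n + m" using n by simp
    have "tuple_deriv h (n + m) (f (n + m)) (tuple_dsum X Y) (tuple_dsum H K) =
        tuple_dsum (tuple_deriv h n (f n) X H) (tuple_deriv h m (f m) Y K)"
      by (rule tuple_deriv_dsum[OF U[OF n] an[OF n] f_in[OF n] U[OF m] an[OF m] f_in[OF m]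
            U[OF nm] f_in[OF nm] dsum(1)[OF n m] dsum(2)[OF n m] X Y])
    \<comment> \<open>Equal lengths make the entrywise direct sum of \<open>X @ H\<close> and
      \<open>Y @ K\<close> split at the same place.\<close>
    moreover have "length X = length Y"
      using sub[OF n X(1)] sub[OF m Y(1)] by (simp add: mat_tuples_length)
    ultimately show "F (n + m) (tuple_dsum Z Z') = tuple_dsum (F n Z) (F m Z')"
      using n m nm X Y dsum(1)[OF n m X(1) Y(1)]
      by (simp add: Z F tuple_append_simps tuple_dsum_closed)
  next
    fix n Z P assume n: "1 \<le> n" and "Z \<in> times_all g \<Omega> n" and P: "P \<in> GL_pairs n"
    then obtain X H where Z: "Z = X @ H" and X: "X \<in> \<Omega> n" "H \<in> mat_tuples g n"
      by (auto simp: times_all_def)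
    have "tuple_deriv h n (f n) (tuple_conj P X) (tuple_conj P H) =
        tuple_conj P (tuple_deriv h n (f n) X H)"
      by (rule tuple_deriv_conj[OF U[OF n] an[OF n] f_in[OF n] P conj(1)[OF n P] conj(2)[OF n P] X])
    then show "F n (tuple_conj P Z) = tuple_conj P (F n Z)"
      using n X P conj(1)[OF n P X(1)]
      by (simp add: Z F tuple_append_simps tuple_conj_closed)
  qed
  moreover have "F n (X @ tuple_add (tuple_smult c H) K) =
      tuple_add (tuple_smult c (F n (X @ H))) (F n (X @ K))"
    if n: "n \<ge> 1" and X: "X \<in> \<Omega> n" and HK: "H \<in> mat_tuples g n" "K \<in> mat_tuples g n" for n X H K c
    using tuple_deriv_linear[OF U[OF n] an[OF n] f_in[OF n] X HK] n X HK
    by (simp add: F tuple_add_closed tuple_smult_closed)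
  moreover have "analytic_map (2 * g) h (times_all g \<Omega>) F"
    unfolding analytic_map_def
    by (intro allI impI analytic_tuple_deriv[OF U an f_in F])
  \<comment> \<open>Free-curl freeness is the instance \<open>L = tuple_zero g n\<close> of
    \<open>symmetric\<close>.\<close>
  ultimately show ?thesis
    using symmetric tuple_zero_closed
    unfolding analytic_free_vector_field_def free_vector_field_def free_curl_free_def by blast
qed

end
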